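(* Let $p$ be a prime number and assume that $\mathbb{F}_p\subseteq R$. Let $\mathcal{X}$ be a collection of subgroups of $G$ that is closed under $G$-conjugation and under taking subgroups. Then $$\operatorname{height} R_{\mathcal{X}}^G = \inf\{\operatorname{height} I_R(P) \mid P \text{ is a } p\text{-subgroup of } G,\ P\notin\mathcal{X}\}.$$
   Context: $G$ is a finite group and $R$ is a commutative ring on which $G$ acts by ring automorphisms $r\mapsto g(r)$; $R^G$ is the subring of $G$-invariants. For a subgroup $H\le G$, the relative trace map is $\operatorname{tr}_{G/H}\colon R^H\to R^G$, $\operatorname{tr}_{G/H}(r)=\sum_{g\in G/H} g(r)$, where $g$ runs over any transversal of the cosets $gH$ of $H$ in $G$; its image is an ideal of $R^G$ denoted $R_H^G$. For a collection $\mathcal{X}$ of subgroups of $G$, $R_{\mathcal{X}}^G=\sum_{H\in\mathcal{X}} R_H^G$, an ideal of $R^G$. For a subgroup $H\le G$, $I_R(H)=\sum_{h\in H}(h-1)(R)R$ is the ideal of $R$ generated by all elements $h(r)-r$ with $h\in H$, $r\in R$. The height of an ideal is the infimum of the heights of the prime ideals containing it, and $\inf\emptyset=\infty$ (so the unit ideal has height $\infty$). The trivial group counts as a $p$-subgroup. *)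

theory Defs
  imports "HOL-Algebra.Algebra" "HOL-Library.Extended_Nat"
begin

section \<open>Height of ideals\<close>

text \<open>The rings are not assumed to be Noetherian, so heights take values in \<open>enat\<close>.
  The supremum ranges over the lengths \<open>n\<close> of chains \<open>C 0 \<subset> \<dots> \<subset> C n = Q\<close> of prime ideals.\<close>

definition prime_height :: "('r, 'n) ring_scheme \<Rightarrow> 'r set \<Rightarrow> enat" where
  "prime_height R Q =
     Sup {enat n | n. \<exists>C :: nat \<Rightarrow> 'r set.
            (\<forall>i\<le>n. primeideal (C i) R) \<and> (\<forall>i<n. C i \<subset> C (Suc i)) \<and> C n = Q}"

text \<open>In \<open>enat\<close> the infimum of the empty set is \<open>\<infinity>\<close>.\<close>

definition height :: "('r, 'n) ring_scheme \<Rightarrow> 'r set \<Rightarrow> enat" where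
  "height R I = (INF Q \<in> {Q. primeideal Q R \<and> I \<subseteq> Q}. prime_height R Q)"

lemma height_unit_ideal: "height R (carrier R) = \<infinity>"
proof -
  have "{Q. primeideal Q R \<and> carrier R \<subseteq> Q} = {}"
    using primeideal.I_notcarr primeideal.axioms(1) ideal.Icarr by fastforce
  then show ?thesis
    unfolding height_def by (simp only: image_empty Inf_empty top_enat_def)
qed


section \<open>Groups acting on commutative rings\<close>

locale ring_action = group_action G "carrier R" \<phi> + R: cring R
  for G (structure) and R (structure) and \<phi> +
  assumes automorphism: "g \<in> carrier G \<Longrightarrow> \<phi> g \<in> ring_iso R R"

definition invariant_ring ::
    "('r, 'n) ring_scheme \<Rightarrow> ('g \<Rightarrow> 'r \<Rightarrow> 'r) \<Rightarrow> 'g set \<Rightarrow> ('r, 'n) ring_scheme" where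
  "invariant_ring R \<phi> H = R\<lparr>carrier := {r \<in> carrier R. \<forall>h\<in>H. \<phi> h r = r}\<rparr>"

text \<open>The transversal is given by a choice of an element of each left coset;
  see \<open>rel_trace_transversal\<close> below for the independence of this choice.\<close>

definition rel_trace ::
    "('g, 'm) monoid_scheme \<Rightarrow> ('r, 'n) ring_scheme \<Rightarrow> ('g \<Rightarrow> 'r \<Rightarrow> 'r) \<Rightarrow> 'g set \<Rightarrow> 'r \<Rightarrow> 'r" where
  "rel_trace G R \<phi> H r = (\<Oplus>\<^bsub>R\<^esub>C \<in> lcosets\<^bsub>G\<^esub> H. \<phi> (SOME g. g \<in> C) r)"

definition trace_ideal ::
    "('g, 'm) monoid_scheme \<Rightarrow> ('r, 'n) ring_scheme \<Rightarrow> ('g \<Rightarrow> 'r \<Rightarrow> 'r) \<Rightarrow> 'g set \<Rightarrow> 'r set" where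
  "trace_ideal G R \<phi> H = rel_trace G R \<phi> H ` carrier (invariant_ring R \<phi> H)"

text \<open>The sum of a finite family of ideals; for a finite group the family \<open>\<F>\<close> is finite.\<close>

definition trace_ideal_sum ::
    "('g, 'm) monoid_scheme \<Rightarrow> ('r, 'n) ring_scheme \<Rightarrow> ('g \<Rightarrow> 'r \<Rightarrow> 'r) \<Rightarrow> 'g set set \<Rightarrow> 'r set" where
  "trace_ideal_sum G R \<phi> \<F> = {\<Oplus>\<^bsub>R\<^esub>H \<in> \<F>. a H | a. a \<in> (\<Pi> H \<in> \<F>. trace_ideal G R \<phi> H)}"

definition augmentation_ideal ::
    "('r, 'n) ring_scheme \<Rightarrow> ('g \<Rightarrow> 'r \<Rightarrow> 'r) \<Rightarrow> 'g set \<Rightarrow> 'r set" where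
  "augmentation_ideal R \<phi> H = Idl\<^bsub>R\<^esub> {\<phi> h r \<ominus>\<^bsub>R\<^esub> r | h r. h \<in> H \<and> r \<in> carrier R}"

context ring_action
begin

lemma act_closed: "g \<in> carrier G \<Longrightarrow> r \<in> carrier R \<Longrightarrow> \<phi> g r \<in> carrier R"
  using element_image by blast

lemma rel_trace_transversal:
  assumes H: "subgroup H G" and r: "r \<in> carrier (invariant_ring R \<phi> H)"
    and T: "\<And>C. C \<in> lcosets H \<Longrightarrow> t C \<in> C"
  shows "rel_trace G R \<phi> H r = (\<Oplus>\<^bsub>R\<^esub>C \<in> lcosets H. \<phi> (t C) r)"
proof -
  interpret G: group G by (rule group_hom.axioms(1)[OF group_hom])
  have rR: "r \<in> carrier R" and inv: "\<And>h. h \<in> H \<Longrightarrow> \<phi> h r = r"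
    using r by (auto simp: invariant_ring_def)
  have sub: "H \<subseteq> carrier G" using H by (rule subgroup.subset)
  have val: "\<phi> x r = \<phi> a r" if "a \<in> carrier G" "x \<in> a <# H" for a x
  proof -
    obtain h where h: "h \<in> H" "x = a \<otimes> h"
      using \<open>x \<in> a <# H\<close> by (auto simp: l_coset_def)
    then show ?thesis
      using composition_rule[OF rR \<open>a \<in> carrier G\<close>, of h] inv sub by auto
  qed
  have car: "x \<in> carrier G" if "C \<in> lcosets H" "x \<in> C" for C x
    using that sub by (auto simp: LCOSETS_def l_coset_def)
  have "\<phi> (SOME g. g \<in> C) r = \<phi> (t C) r \<and> \<phi> (t C) r \<in> carrier R" if C: "C \<in> lcosets H" for C
  proof -
    obtain a where a: "a \<in> carrier G" "C = a <# H"
      using C by (auto simp: LCOSETS_def)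
    have "(SOME g. g \<in> C) \<in> C" using T[OF C] by (rule someI)
    then show ?thesis
      using val[OF a(1)] a(2) T[OF C] act_closed[OF car[OF C T[OF C]] rR] by metis
  qed
  then show ?thesis
    unfolding rel_trace_def by (intro R.finsum_cong') auto
qed

end

end

theory Submission
  imports Defs
begin

text \<open>For a prime ideal \<open>Q\<close> of \<open>R\<close> let \<open>T\<close> be its inertia group, so that \<open>I\<^sub>R(P) \<subseteq> Q\<close> iff \<open>P \<subseteq> T\<close>.
  The trace ideals of all \<open>H \<in> \<F>\<close> lie in \<open>Q\<close> iff some \<open>p\<close>-subgroup of \<open>T\<close> is not in \<open>\<F>\<close>.
  If \<open>P \<subseteq> T\<close> is such a \<open>p\<close>-subgroup, it acts without fixed points on every \<open>G/H\<close>, and modulo \<open>Q\<close> the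
  summands of the trace are constant on its orbits, whose sizes are divisible by \<open>p\<close>. Otherwise a Sylow
  \<open>p\<close>-subgroup of \<open>T\<close> is in \<open>\<F>\<close>, and independence of characters with values in \<open>R/Q\<close> provides an element whose
  trace is not in \<open>Q\<close>. Finally, \<open>Q\<close> and its contraction to the ring of invariants have the same
  height, since primes lift, and \<open>Q \<inter> R\<^sup>G \<subseteq> Q'\<close> forces \<open>Q\<close> into a translate of \<open>Q'\<close> by prime avoidance.\<close>

section \<open>Independence of characters\<close>

text \<open>Dedekind's argument, by induction on \<open>I\<close>. The characters
  \<open>\<chi> i\<close> may coincide for different \<open>i\<close>, so that only the sum of the
  weights over the class of \<open>\<chi> j\<close> has to vanish, not each weight.\<close>

lemma (in domain) weighted_independence_of_characters:
  assumes "finite I" and "Group.monoid M" and "j \<in> I"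
    and "\<And>i. i \<in> I \<Longrightarrow> \<chi> i \<in> hom M R" and "\<And>i. i \<in> I \<Longrightarrow> \<chi> i \<one>\<^bsub>M\<^esub> = \<one>"
    and "c \<in> I \<rightarrow> carrier R"
    and "\<And>b. b \<in> carrier M \<Longrightarrow> (\<Oplus>i\<in>I. c i \<otimes> \<chi> i b) = \<zero>"
  shows "(\<Oplus>i \<in> {i \<in> I. \<forall>b \<in> carrier M. \<chi> i b = \<chi> j b}. c i) = \<zero>"
  using assms
proof (induction I arbitrary: c rule: finite_psubset_induct)
  case (psubset I)
  interpret M: Group.monoid M by fact
  let ?E = "\<lambda>I. {i \<in> I. \<forall>b \<in> carrier M. \<chi> i b = \<chi> j b}"
  have chi: "\<chi> i b \<in> carrier R" if "i \<in> I" "b \<in> carrier M" for i b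
    using psubset.prems(3)[OF that(1)] that(2) by (auto simp: hom_def)
  have chi_mult: "\<chi> i (b \<otimes>\<^bsub>M\<^esub> b') = \<chi> i b \<otimes> \<chi> i b'"
    if "i \<in> I" "b \<in> carrier M" "b' \<in> carrier M" for i b b'
    using psubset.prems(3)[OF that(1)] that(2,3) by (auto simp: hom_def)
  have c: "c i \<in> carrier R" if "i \<in> I" for i
    using psubset.prems(5) that by auto
  show ?case
  proof (cases "?E I = I")
    case True
    \<comment> \<open>If there is only one class, the relation at the unit of \<open>M\<close> is
      already the claim.\<close>
    have "(\<Oplus>i\<in>I. c i) = (\<Oplus>i\<in>I. c i \<otimes> \<chi> i \<one>\<^bsub>M\<^esub>)"
      using psubset.prems(4) c by (intro finsum_cong') auto
    then show ?thesis
      using psubset.prems(6)[of "\<one>\<^bsub>M\<^esub>"] True by simp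
  next
    case False
    then obtain l d where l: "l \<in> I" and d: "d \<in> carrier M" and ne: "\<chi> l d \<noteq> \<chi> j d"
      by auto
    then have lj: "l \<noteq> j" by auto
    \<comment> \<open>These are the weights of the relation at \<open>d b\<close> minus
      \<open>\<chi> l d\<close> times the relation at \<open>b\<close>. The index \<open>l\<close>
      drops out, while all weights in the class of \<open>j\<close> are multiplied by the same
      nonzero element \<open>\<chi> j d \<ominus> \<chi> l d\<close>.\<close>
    define c' where "c' i = c i \<otimes> (\<chi> i d \<ominus> \<chi> l d)" for i
    have c': "c' i \<in> carrier R" if "i \<in> I" for i
      using that c chi d l by (simp add: c'_def)
    have "(\<Oplus>i\<in>?E (I - {l}). c' i) = \<zero>"
    proof (rule psubset.IH)
      show "I - {l} \<subset> I" using l by auto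
      show "(\<Oplus>i\<in>I - {l}. c' i \<otimes> \<chi> i b) = \<zero>" if b: "b \<in> carrier M" for b
      proof -
        have "(\<Oplus>i\<in>I - {l}. c' i \<otimes> \<chi> i b) = (\<Oplus>i\<in>I. c' i \<otimes> \<chi> i b)"
          using c c' chi l b d psubset.hyps
          by (intro add.finprod_mono_neutral_cong_left) (auto simp: c'_def r_neg minus_eq)
        also have "\<dots> = (\<Oplus>i\<in>I. c i \<otimes> \<chi> i (d \<otimes>\<^bsub>M\<^esub> b) \<oplus> (c i \<otimes> \<chi> i b) \<otimes> (\<ominus> \<chi> l d))"
        proof (intro finsum_cong')
          fix i assume i: "i \<in> I"
          have "c i \<in> carrier R" "\<chi> i d \<in> carrier R" "\<chi> i b \<in> carrier R" "\<chi> l d \<in> carrier R"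
            using i c chi d b l by auto
          then show "c' i \<otimes> \<chi> i b = c i \<otimes> \<chi> i (d \<otimes>\<^bsub>M\<^esub> b) \<oplus> (c i \<otimes> \<chi> i b) \<otimes> (\<ominus> \<chi> l d)"
            unfolding c'_def chi_mult[OF i d b] by algebra
        qed (use c chi d b l in auto)
        also have "\<dots> = (\<Oplus>i\<in>I. c i \<otimes> \<chi> i (d \<otimes>\<^bsub>M\<^esub> b)) \<oplus> (\<Oplus>i\<in>I. (c i \<otimes> \<chi> i b) \<otimes> (\<ominus> \<chi> l d))"
          using c chi d b l by (intro finsum_addf) auto
        also have "(\<Oplus>i\<in>I. (c i \<otimes> \<chi> i b) \<otimes> (\<ominus> \<chi> l d)) = (\<Oplus>i\<in>I. c i \<otimes> \<chi> i b) \<otimes> (\<ominus> \<chi> l d)"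
          using c chi d b l psubset.hyps by (intro finsum_ldistr[symmetric]) auto
        finally show ?thesis
          using psubset.prems(6) b d l chi by simp
      qed
    qed (use psubset.prems lj c' in auto)
    also have "?E (I - {l}) = ?E I" using ne d by auto
    also have "(\<Oplus>i\<in>?E I. c' i) = (\<Oplus>i\<in>?E I. c i \<otimes> (\<chi> j d \<ominus> \<chi> l d))"
      using c chi d l psubset.prems(2) by (intro finsum_cong') (auto simp: c'_def)
    also have "\<dots> = (\<Oplus>i\<in>?E I. c i) \<otimes> (\<chi> j d \<ominus> \<chi> l d)"
      using c chi d l psubset.prems(2) psubset.hyps by (intro finsum_ldistr[symmetric]) auto
    finally show ?thesis
      using ne chi[OF l d] chi[OF psubset.prems(2) d] c
      by (subst (asm) integral_iff) auto
  qed
qed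

section \<open>Ideals and prime ideals\<close>

text \<open>Zorn's lemma relative to a property \<open>\<Phi>\<close> that survives unions. The
  trivial property serves to find prime ideals, and stability under the group serves to find the
  ideal \<open>J\<close> in \<open>lying_over\<close>.\<close>

lemma (in cring) exists_maximal_ideal_satisfying:
  assumes "ideal J R" and "J \<inter> S = {}" and "\<Phi> J"
    and Union: "\<And>C. (\<And>K. K \<in> C \<Longrightarrow> \<Phi> K) \<Longrightarrow> \<Phi> (\<Union>C)"
  obtains M where "ideal M R" "J \<subseteq> M" "M \<inter> S = {}" "\<Phi> M"
    "\<And>K. ideal K R \<Longrightarrow> M \<subseteq> K \<Longrightarrow> K \<inter> S = {} \<Longrightarrow> \<Phi> K \<Longrightarrow> K = M"
proof -
  define T where "T = {K. ideal K R \<and> J \<subseteq> K \<and> K \<inter> S = {} \<and> \<Phi> K}"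
  have "\<exists>M\<in>T. \<forall>K\<in>T. M \<subseteq> K \<longrightarrow> K = M"
  proof (rule subset_Zorn_nonempty)
    show "T \<noteq> {}" using assms(1-3) unfolding T_def by blast
    fix C assume C: "C \<noteq> {}" "subset.chain T C"
    then have CT: "C \<subseteq> T" by (simp add: subset_chain_def)
    have "subset.chain {I. ideal I R} C"
      using C(2) CT unfolding T_def subset_chain_def by blast
    from chain_Union_is_ideal[OF this] C(1) have "ideal (\<Union>C) R" by simp
    moreover have "\<Phi> (\<Union>C)"
      using CT unfolding T_def by (intro Union) blast
    moreover have "J \<subseteq> \<Union>C" using CT C(1) unfolding T_def by blast
    moreover have "\<Union>C \<inter> S = {}" using CT unfolding T_def by blast
    ultimately show "\<Union>C \<in> T" unfolding T_def by blast
  qed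
  then obtain M where M: "M \<in> T" and max: "\<forall>K\<in>T. M \<subseteq> K \<longrightarrow> K = M" by blast
  show ?thesis
  proof (rule that)
    show "ideal M R" "J \<subseteq> M" "M \<inter> S = {}" "\<Phi> M"
      using M by (simp_all add: T_def)
    show "K = M" if "ideal K R" "M \<subseteq> K" "K \<inter> S = {}" "\<Phi> K" for K
    proof -
      have "K \<in> T" using M that unfolding T_def by blast
      then show ?thesis using max that(2) by blast
    qed
  qed
qed

lemma (in cring) ideal_add_cgenideal:
  assumes "ideal J R" and "a \<in> carrier R"
  shows "ideal (J <+>\<^bsub>R\<^esub> PIdl a) R" and "J \<subseteq> J <+>\<^bsub>R\<^esub> PIdl a" and "a \<in> J <+>\<^bsub>R\<^esub> PIdl a"
    and "x \<in> J <+>\<^bsub>R\<^esub> PIdl a \<longleftrightarrow> (\<exists>u\<in>J. \<exists>r\<in>carrier R. x = u \<oplus> r \<otimes> a)"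
proof -
  interpret J: ideal J R by fact
  show "ideal (J <+>\<^bsub>R\<^esub> PIdl a) R"
    using assms cgenideal_ideal add_ideals by blast
  show mem: "x \<in> J <+>\<^bsub>R\<^esub> PIdl a \<longleftrightarrow> (\<exists>u\<in>J. \<exists>r\<in>carrier R. x = u \<oplus> r \<otimes> a)" for x
    by (auto simp: set_add_def' cgenideal_def)
  show "J \<subseteq> J <+>\<^bsub>R\<^esub> PIdl a"
  proof
    fix x assume "x \<in> J"
    then show "x \<in> J <+>\<^bsub>R\<^esub> PIdl a"
      unfolding mem by (intro bexI[of _ x] bexI[of _ \<zero>]) (simp_all add: assms(2))
  qed
  show "a \<in> J <+>\<^bsub>R\<^esub> PIdl a"
    unfolding mem by (intro bexI[of _ \<zero>] bexI[of _ \<one>]) (simp_all add: assms(2))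
qed

text \<open>By maximality, adjoining any outside element to \<open>P\<close> produces an ideal that
  meets \<open>S\<close>. If \<open>a \<otimes> b\<close> were in \<open>P\<close> with
  \<open>a\<close> and \<open>b\<close> outside, the product of the two elements of \<open>S\<close>
  found in this way would lie in \<open>P\<close> as well.\<close>

lemma (in cring) exists_primeideal_avoiding:
  assumes "ideal J R" and "S \<subseteq> carrier R" and "\<one> \<in> S"
    and S_mult: "\<And>s t. s \<in> S \<Longrightarrow> t \<in> S \<Longrightarrow> s \<otimes> t \<in> S" and "J \<inter> S = {}"
  obtains P where "primeideal P R" "J \<subseteq> P" "P \<inter> S = {}"
proof -
  obtain P where P: "ideal P R" "J \<subseteq> P" "P \<inter> S = {}"
    and max: "\<And>K. ideal K R \<Longrightarrow> P \<subseteq> K \<Longrightarrow> K \<inter> S = {} \<Longrightarrow> K = P"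
    by (rule exists_maximal_ideal_satisfying[OF assms(1,5), of "\<lambda>_. True"]) blast+
  interpret P: ideal P R by fact
  have meets: "\<exists>s\<in>S. \<exists>u\<in>P. \<exists>r\<in>carrier R. s = u \<oplus> r \<otimes> a" if a: "a \<in> carrier R" "a \<notin> P" for a
  proof -
    have "(P <+>\<^bsub>R\<^esub> PIdl a) \<inter> S \<noteq> {}"
      using max[OF ideal_add_cgenideal(1,2)[OF P(1) a(1)]] ideal_add_cgenideal(3)[OF P(1) a(1)] a(2)
      by metis
    then show ?thesis
      using ideal_add_cgenideal(4)[OF P(1) a(1)] by blast
  qed
  have "primeideal P R"
  proof (rule primeidealI)
    show "carrier R \<noteq> P" using P(3) assms(3) by auto
    fix a b assume ab: "a \<in> carrier R" "b \<in> carrier R" "a \<otimes> b \<in> P"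
    show "a \<in> P \<or> b \<in> P"
    proof (rule ccontr)
      assume "\<not> (a \<in> P \<or> b \<in> P)"
      then obtain s u r t v q where
        s: "s \<in> S" "u \<in> P" "r \<in> carrier R" "s = u \<oplus> r \<otimes> a" and
        t: "t \<in> S" "v \<in> P" "q \<in> carrier R" "t = v \<oplus> q \<otimes> b"
        using meets[of a] meets[of b] ab by metis
      have [simp]: "u \<in> carrier R" "v \<in> carrier R" using s t P.a_subset by auto
      \<comment> \<open>Each of the three summands has a factor in \<open>P\<close>.\<close>
      have "s \<otimes> t = u \<otimes> (v \<oplus> q \<otimes> b) \<oplus> v \<otimes> (r \<otimes> a) \<oplus> (r \<otimes> q) \<otimes> (a \<otimes> b)"
        unfolding s(4) t(4) using \<open>u \<in> carrier R\<close> \<open>v \<in> carrier R\<close> s(3) t(3) ab(1,2) by algebra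
      also have "\<dots> \<in> P"
        using s t ab by (intro P.a_closed P.I_r_closed[of u] P.I_r_closed[of v] P.I_l_closed[of "a \<otimes> b"]) auto
      finally show False using P(3) S_mult[OF s(1) t(1)] by auto
    qed
  qed (use P is_cring in auto)
  then show ?thesis using P that by blast
qed

section \<open>Prime avoidance, and products in prime ideals\<close>

lemma (in cring) exists_in_ideals_not_in_primeideal:
  assumes "finite A" and P: "primeideal P R"
    and "\<And>I. I \<in> A \<Longrightarrow> ideal I R" and "\<And>I. I \<in> A \<Longrightarrow> \<not> I \<subseteq> P"
  shows "\<exists>a \<in> carrier R. a \<notin> P \<and> (\<forall>I\<in>A. a \<in> I)"
  using assms(1,3,4)
proof (induction A rule: finite_induct)
  interpret P: primeideal P R by fact
  case empty
  then show ?case using P.I_notcarr P.a_subset by auto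
next
  interpret P: primeideal P R by fact
  case (insert I A)
  then obtain a where a: "a \<in> carrier R" "a \<notin> P" "\<forall>I\<in>A. a \<in> I" by auto
  obtain b where b: "b \<in> I" "b \<notin> P" using insert.prems(2) by blast
  have bR: "b \<in> carrier R"
    using ideal.Icarr[OF insert.prems(1) b(1)] by auto
  have "a \<otimes> b \<in> K" if "K \<in> insert I A" for K
  proof -
    interpret K: ideal K R using insert.prems that by auto
    from that show ?thesis using a b bR K.I_l_closed K.I_r_closed by auto
  qed
  moreover have "a \<otimes> b \<notin> P" using P.I_prime a b bR by blast
  ultimately show ?case using a bR by auto
qed

text \<open>Incomparability permits a direct correction: if an element of \<open>I\<close> avoiding
  the earlier primes falls into the new prime \<open>P\<close>, add an element of \<open>I\<close>
  that lies in all earlier primes but not in \<open>P\<close>. The translates of one prime under a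
  finite group are incomparable in this sense.\<close>

lemma (in cring) prime_avoidance_incomparable:
  assumes "finite A" and I: "ideal I R"
    and "\<And>Q. Q \<in> A \<Longrightarrow> primeideal Q R" and "\<And>Q Q'. Q \<in> A \<Longrightarrow> Q' \<in> A \<Longrightarrow> Q \<subseteq> Q' \<Longrightarrow> Q = Q'"
    and "\<And>Q. Q \<in> A \<Longrightarrow> \<not> I \<subseteq> Q"
  shows "\<exists>x\<in>I. \<forall>Q\<in>A. x \<notin> Q"
  using assms(1,3-)
proof (induction A rule: finite_induct)
  interpret I: ideal I R by fact
  case empty
  then show ?case by (auto intro: I.zero_closed)
next
  interpret I: ideal I R by fact
  case (insert P A)
  then obtain x where x: "x \<in> I" "\<forall>Q\<in>A. x \<notin> Q" by (metis insertCI)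
  interpret P: primeideal P R using insert.prems by auto
  show ?case
  proof (cases "x \<in> P")
    case False
    then show ?thesis using x by auto
  next
    case True
    \<comment> \<open>None of these ideals is contained in \<open>P\<close>: for \<open>I\<close>
      this is assumed, for a prime in \<open>A\<close> it follows from incomparability and
      \<open>P \<notin> A\<close>.\<close>
    have "\<exists>z\<in>carrier R. z \<notin> P \<and> (\<forall>Q\<in>insert I A. z \<in> Q)"
      using insert I by (intro exists_in_ideals_not_in_primeideal) (auto dest: primeideal.axioms(1))
    then obtain z where z: "z \<in> I" "z \<notin> P" "\<And>Q. Q \<in> A \<Longrightarrow> z \<in> Q" by auto
    have xz: "x \<in> carrier R" "z \<in> carrier R" using x z I.Icarr by auto
    have "x \<oplus> z \<notin> P"
    proof
      assume "x \<oplus> z \<in> P"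
      then have "(x \<oplus> z) \<ominus> x \<in> P" using True by (simp add: minus_eq)
      also have "(x \<oplus> z) \<ominus> x = z" using xz by algebra
      finally show False using z by simp
    qed
    moreover have "x \<oplus> z \<notin> Q" if Q: "Q \<in> A" for Q
    proof
      interpret Q: primeideal Q R using insert.prems Q by auto
      assume "x \<oplus> z \<in> Q"
      then have "(x \<oplus> z) \<ominus> z \<in> Q" using z(3)[OF Q] by (simp add: minus_eq)
      also have "(x \<oplus> z) \<ominus> z = x" using xz by algebra
      finally show False using x Q by simp
    qed
    ultimately show ?thesis using x z by auto
  qed
qed

lemma (in primeideal) finprod_mem_imp:
  assumes "finite A" and "f \<in> A \<rightarrow> carrier R" and "finprod R f A \<in> I"
  shows "\<exists>x\<in>A. f x \<in> I"
  using assms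
proof (induction A rule: finite_induct)
  case empty
  then show ?case using one_imp_carrier I_notcarr by simp
next
  case (insert x A)
  then have "f x \<otimes> finprod R f A \<in> I" by (simp add: Pi_def)
  then have "f x \<in> I \<or> finprod R f A \<in> I"
    using insert.prems(1) by (intro I_prime) auto
  then show ?case using insert by auto
qed

lemma (in primeideal) pow_mem_imp:
  assumes "x \<in> carrier R" and "x [^] (n::nat) \<in> I"
  shows "x \<in> I"
  using assms(2)
proof (induction n)
  case 0
  then show ?case using one_imp_carrier I_notcarr by simp
next
  case (Suc n)
  then show ?case using I_prime[of "x [^] n" x] assms(1) by auto
qed

lemma (in ideal) finprod_mem:
  assumes "cring R" and "finite A" and "f \<in> A \<rightarrow> carrier R" and "y \<in> A" and "f y \<in> I"
  shows "finprod R f A \<in> I"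
proof -
  interpret cring R by fact
  have "finprod R f A = f y \<otimes> finprod R f (A - {y})"
    using assms by (subst insert_Diff[OF \<open>y \<in> A\<close>, symmetric], subst finprod_insert) auto
  then show ?thesis
    using assms by (simp add: I_r_closed Pi_def)
qed

lemma (in ideal) rcos_eq_zero_iff:
  assumes "x \<in> carrier R"
  shows "I +> x = \<zero>\<^bsub>R Quot I\<^esub> \<longleftrightarrow> x \<in> I"
proof -
  have "\<zero>\<^bsub>R Quot I\<^esub> = I" by (simp add: FactRing_def)
  then show ?thesis
    using assms rcos_const_imp_mem a_rcos_zero[OF is_ideal] by metis
qed

section \<open>Characteristic \<open>p\<close>\<close>

lemma (in ideal) quotient_char:
  assumes "cring R" and "[(p::nat)] \<cdot> \<one> = \<zero>"
  shows "[p] \<cdot>\<^bsub>R Quot I\<^esub> \<one>\<^bsub>R Quot I\<^esub> = \<zero>\<^bsub>R Quot I\<^esub>"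
proof -
  interpret \<pi>: ring_hom_cring R "R Quot I" "(+>) I"
    using assms(1) by (rule rcos_ring_hom_cring)
  have "[n] \<cdot>\<^bsub>R Quot I\<^esub> \<one>\<^bsub>R Quot I\<^esub> = I +> ([n] \<cdot> \<one>)" for n :: nat
    by (induction n) simp_all
  then show ?thesis using assms(2) by simp
qed

text \<open>The inclusion of the prime field is given as a homomorphism from the integers modulo
  \<open>p\<close>, while all later steps use it in the form of this equation. By induction on
  \<open>n\<close>, the class of \<open>n\<close> is mapped to \<open>n\<close> times the unit of
  \<open>R\<close>.\<close>

lemma char_of_ZFact_hom:
  assumes "ring R" and "f \<in> ring_hom (ZFact (int p)) R"
  shows "[p] \<cdot>\<^bsub>R\<^esub> \<one>\<^bsub>R\<^esub> = \<zero>\<^bsub>R\<^esub>"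
proof -
  interpret R: ring R by fact
  interpret Z: cring "ZFact (int p)" by (rule ZFact_is_cring)
  interpret f: ring_hom_ring "ZFact (int p)" R f
    using assms Z.ring_axioms by (intro ring_hom_ringI2) auto
  let ?I = "Idl\<^bsub>\<Z>\<^esub> {int p}"
  interpret I: ideal ?I \<Z> by (rule int.genideal_ideal) simp
  have hom: "(+>\<^bsub>\<Z>\<^esub>) ?I \<in> ring_hom \<Z> (ZFact (int p))"
    unfolding ZFact_def by (rule I.rcos_ring_hom)
  have "f (?I +>\<^bsub>\<Z>\<^esub> int n) = [n] \<cdot>\<^bsub>R\<^esub> \<one>\<^bsub>R\<^esub>" for n
  proof (induction n)
    case 0
    have "?I +>\<^bsub>\<Z>\<^esub> 0 = \<zero>\<^bsub>ZFact (int p)\<^esub>"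
      using ring_hom_zero[OF hom int.ring_axioms Z.ring_axioms] by simp
    then show ?case by simp
  next
    case (Suc n)
    have "?I +>\<^bsub>\<Z>\<^esub> int (Suc n) = (?I +>\<^bsub>\<Z>\<^esub> int n) \<oplus>\<^bsub>ZFact (int p)\<^esub> \<one>\<^bsub>ZFact (int p)\<^esub>"
      using ring_hom_add[OF hom, of "int n" 1] ring_hom_one[OF hom] by (simp add: add.commute)
    then show ?case
      using Suc.IH ring_hom_closed[OF hom, of "int n"] by simp
  qed
  moreover have "?I +>\<^bsub>\<Z>\<^esub> int p = \<zero>\<^bsub>ZFact (int p)\<^esub>"
    unfolding ZFact_def using int.genideal_self'[of "int p"] I.rcos_eq_zero_iff[of "int p"] by simp
  ultimately show ?thesis by (metis f.hom_zero)
qed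

section \<open>The Frobenius map in characteristic \<open>p\<close>\<close>

lemma (in cring) binomial_expansion:
  assumes x: "x \<in> carrier R" and y: "y \<in> carrier R"
  shows "(x \<oplus> y) [^] (n::nat) = (\<Oplus>k\<in>{..n}. [(n choose k)] \<cdot> (x [^] k \<otimes> y [^] (n - k)))"
proof (induction n)
  case 0
  show ?case using x y by simp
next
  case (Suc n)
  \<comment> \<open>\<open>g\<close> collects the products with the new factor \<open>x\<close>,
    \<open>f\<close> those with \<open>y\<close>. The monomials of \<open>g k\<close> and
    \<open>f (Suc k)\<close> agree, and Pascal's rule adds their coefficients.\<close>
  define f where "f k = [(n choose k)] \<cdot> (x [^] k \<otimes> y [^] (Suc n - k))" for k
  define g where "g k = [(n choose k)] \<cdot> (x [^] Suc k \<otimes> y [^] (n - k))" for k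
  have f: "f k \<in> carrier R" and g: "g k \<in> carrier R" for k
    using x y by (simp_all add: f_def g_def)
  have "(x \<oplus> y) [^] Suc n = (\<Oplus>k\<in>{..n}. [(n choose k)] \<cdot> (x [^] k \<otimes> y [^] (n - k))) \<otimes> (x \<oplus> y)"
    by (simp add: Suc.IH)
  also have "\<dots> = (\<Oplus>k\<in>{..n}. [(n choose k)] \<cdot> (x [^] k \<otimes> y [^] (n - k)) \<otimes> (x \<oplus> y))"
    using x y by (intro finsum_ldistr) auto
  also have "\<dots> = (\<Oplus>k\<in>{..n}. g k \<oplus> f k)"
  proof (intro finsum_cong')
    fix k assume k: "k \<in> {..n}"
    let ?u = "x [^] k" and ?v = "y [^] (n - k)"
    have uv: "?u \<in> carrier R" "?v \<in> carrier R" using x y by auto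
    have "?u \<otimes> ?v \<otimes> (x \<oplus> y) = ?u \<otimes> x \<otimes> ?v \<oplus> ?u \<otimes> (?v \<otimes> y)"
      using uv x y by algebra
    also have "?v \<otimes> y = y [^] (Suc n - k)" using k by (simp add: Suc_diff_le)
    finally show "[(n choose k)] \<cdot> (?u \<otimes> ?v) \<otimes> (x \<oplus> y) = g k \<oplus> f k"
      using x y uv by (simp add: f_def g_def add_pow_ldistr add.nat_pow_distrib)
  qed (use f g in auto)
  also have "\<dots> = (\<Oplus>k\<in>{..n}. g k) \<oplus> (\<Oplus>k\<in>{..n}. f k)"
    using f g by (intro finsum_addf) auto
  also have "(\<Oplus>k\<in>{..n}. f k) = (\<Oplus>k\<in>{..Suc n}. f k)"
  proof -
    \<comment> \<open>The coefficient is \<open>n choose Suc n\<close>, which is zero, so the range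
      may be extended by one before it is shifted.\<close>
    have "f (Suc n) = \<zero>" by (simp add: f_def binomial_eq_0)
    then show ?thesis using f finsum_Suc[of f n] by simp
  qed
  also have "\<dots> = (\<Oplus>k\<in>{..n}. f (Suc k)) \<oplus> f 0"
    using f by (intro finsum_Suc2) auto
  also have "(\<Oplus>k\<in>{..n}. g k) \<oplus> ((\<Oplus>k\<in>{..n}. f (Suc k)) \<oplus> f 0) = (\<Oplus>k\<in>{..n}. g k \<oplus> f (Suc k)) \<oplus> f 0"
    using f g by (simp add: finsum_addf a_assoc Pi_def)
  also have "\<dots> = (\<Oplus>k\<in>{..Suc n}. [(Suc n choose k)] \<cdot> (x [^] k \<otimes> y [^] (Suc n - k)))"
    using x y f g
    by (subst finsum_Suc2)
      (auto simp: f_def g_def add.nat_pow_mult intro!: arg_cong2[of _ _ _ _ "(\<oplus>)"] finsum_cong')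
  finally show ?case .
qed

lemma (in cring) add_pow_eq_zero:
  assumes "[(p::nat)] \<cdot> \<one> = \<zero>" and "p dvd n" and x: "x \<in> carrier R"
  shows "[n] \<cdot> x = \<zero>"
proof -
  obtain m where n: "n = p * m" using assms(2) by blast
  have "[p] \<cdot> x = ([p] \<cdot> \<one>) \<otimes> x" using x by (simp add: add_pow_ldistr)
  then have "[p] \<cdot> x = \<zero>" using assms(1) x by simp
  then show ?thesis
    using x by (simp add: n add.nat_pow_pow[symmetric])
qed

lemma (in cring) add_prime_power:
  assumes p: "Factorial_Ring.prime (p::nat)" and char: "[p] \<cdot> \<one> = \<zero>"
    and x: "x \<in> carrier R" and y: "y \<in> carrier R"
  shows "(x \<oplus> y) [^] (p ^ k) = x [^] (p ^ k) \<oplus> y [^] (p ^ k)"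
  using x y
proof (induction k arbitrary: x y)
  case 0
  then show ?case by simp
next
  case (Suc k)
  have dream: "(u \<oplus> v) [^] p = u [^] p \<oplus> v [^] p" if uv: "u \<in> carrier R" "v \<in> carrier R" for u v
  proof -
    have p0: "0 < p" using p by (rule prime_gt_0_nat)
    define f where "f i = [(p choose i)] \<cdot> (u [^] i \<otimes> v [^] (p - i))" for i
    have f: "f i \<in> carrier R" for i using uv by (simp add: f_def)
    \<comment> \<open>The binomial coefficients strictly between the two ends are divisible by
      \<open>p\<close>.\<close>
    have "(\<Oplus>i\<in>{..p}. f i) = (\<Oplus>i\<in>{p, 0}. f i)"
    proof (intro add.finprod_mono_neutral_cong_right)
      show "f i = \<zero>" if "i \<in> {..p} - {p, 0}" for i
        unfolding f_def using that p uv
        by (intro add_pow_eq_zero[OF char] dvd_choose_prime) auto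
    qed (use f in auto)
    also have "\<dots> = u [^] p \<oplus> v [^] p"
      using f p0 uv by (simp add: f_def)
    finally show ?thesis
      using binomial_expansion[OF uv, of p] unfolding f_def by simp
  qed
  have "(x \<oplus> y) [^] (p ^ Suc k) = ((x \<oplus> y) [^] (p ^ k)) [^] p"
    using Suc.prems by (simp add: nat_pow_pow mult.commute)
  also have "\<dots> = (x [^] (p ^ k)) [^] p \<oplus> (y [^] (p ^ k)) [^] p"
    using Suc by (simp add: dream)
  also have "\<dots> = x [^] (p ^ Suc k) \<oplus> y [^] (p ^ Suc k)"
    using Suc.prems by (simp add: nat_pow_pow mult.commute)
  finally show ?case .
qed

lemma (in cring) finsum_prime_power:
  assumes p: "Factorial_Ring.prime (p::nat)" and char: "[p] \<cdot> \<one> = \<zero>"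
    and "f \<in> A \<rightarrow> carrier R"
  shows "(\<Oplus>i\<in>A. f i) [^] (p ^ k) = (\<Oplus>i\<in>A. f i [^] (p ^ k))"
  using assms(3)
proof (induction A rule: infinite_finite_induct)
  case (insert i A)
  then show ?case by (simp add: add_prime_power[OF p char] Pi_def)
\<comment> \<open>For an empty or infinite \<open>A\<close> both sums are zero by convention; zero
  to the power \<open>p ^ k\<close> is zero because the exponent is positive.\<close>
qed (use prime_gt_0_nat[OF p] in \<open>simp_all add: nat_pow_zero\<close>)

section \<open>Actions on left cosets\<close>

text \<open>The sum over an orbit \<open>B\<close> is \<open>card B\<close> times one value of
  \<open>f\<close>. By the orbit-stabilizer theorem \<open>card B\<close> divides
  \<open>p ^ k\<close>, and it exceeds 1 because no point is fixed; so \<open>p\<close> divides it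
  and the orbit contributes zero.\<close>

lemma (in abelian_monoid) finsum_eq_zero_of_p_group_action:
  assumes act: "group_action P E \<psi>" and fin: "finite E"
    and p: "Factorial_Ring.prime (p::nat)" and ord: "order P = p ^ k"
    and char: "\<And>x. x \<in> carrier G \<Longrightarrow> [p] \<cdot> x = \<zero>"
    and f: "f \<in> E \<rightarrow> carrier G"
    and invar: "\<And>g e. g \<in> carrier P \<Longrightarrow> e \<in> E \<Longrightarrow> f (\<psi> g e) = f e"
    and nofix: "\<And>e. e \<in> E \<Longrightarrow> \<exists>g\<in>carrier P. \<psi> g e \<noteq> e"
  shows "(\<Oplus>e\<in>E. f e) = \<zero>"
proof -
  interpret \<psi>: group_action P E \<psi> by fact
  have cover: "\<Union>(orbits P E \<psi>) = E" by (rule \<psi>.orbits_coverture)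
  then have sub: "B \<subseteq> E" if "B \<in> orbits P E \<psi>" for B using that by blast
  have zero: "(\<Oplus>e\<in>B. f e) = \<zero>" if B: "B \<in> orbits P E \<psi>" for B
  proof -
    obtain e where e: "e \<in> E" and B_eq: "B = orbit P \<psi> e"
      using B by (auto simp: orbits_def)
    have fe: "f e \<in> carrier G" using f e by auto
    have "card B dvd p ^ k"
      unfolding B_eq ord[symmetric] \<psi>.orbit_stabilizer_theorem[OF e, symmetric] by simp
    then obtain j where j: "card B = p ^ j" using divides_primepow_nat[OF p] by blast
    obtain g where g: "g \<in> carrier P" "\<psi> g e \<noteq> e" using nofix[OF e] by blast
    have "\<psi> g e \<in> B" using g(1) unfolding B_eq orbit_def by blast
    moreover have "e \<in> B" using \<psi>.orbit_refl[OF e] unfolding B_eq .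
    ultimately have "card {\<psi> g e, e} \<le> card B"
      using finite_subset[OF sub[OF B] fin] by (intro card_mono) simp_all
    then have "2 \<le> card B" using g(2) by simp
    then have "p dvd card B" using j by (cases j) auto
    then obtain m where m: "card B = p * m" by blast
    have "(\<Oplus>e\<in>B. f e) = (\<Oplus>e'\<in>B. f e)"
      using invar e fe by (intro finsum_cong') (auto simp: B_eq orbit_def)
    also have "\<dots> = [card B] \<cdot> f e"
      using fe by (rule add.finprod_const)
    also have "\<dots> = [m] \<cdot> ([p] \<cdot> f e)"
      using fe by (simp add: m add.nat_pow_pow)
    finally show ?thesis using char[OF fe] by simp
  qed
  have "(\<Oplus>e\<in>\<Union>(orbits P E \<psi>). f e) = (\<Oplus>B\<in>orbits P E \<psi>. \<Oplus>e\<in>B. f e)"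
  proof (rule add.finprod_Union_disjoint)
    show "finite (orbits P E \<psi>)" using fin cover by (metis finite_UnionD)
    show "finite B \<and> (\<forall>x\<in>B. f x \<in> carrier G)" if "B \<in> orbits P E \<psi>" for B
      using finite_subset[OF sub[OF that] fin] f sub[OF that] by auto
    show "pairwise disjnt (orbits P E \<psi>)"
      using \<psi>.disjoint_union unfolding pairwise_def disjnt_def by blast
  qed
  also have "\<dots> = \<zero>" using zero by (rule add.finprod_one_eqI)
  finally show ?thesis unfolding cover .
qed

text \<open>The translations are restricted to \<open>lcosets H\<close> because the elements of
  \<open>BijGroup\<close> are extensional functions. Translation by \<open>inv g\<close> is the
  inverse bijection.\<close>

lemma (in group) action_on_lcosets:
  assumes H: "subgroup H G"
  shows "group_action G (lcosets H) (\<lambda>g. \<lambda>C \<in> lcosets H. g <# C)"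
proof -
  let ?E = "lcosets H"
  let ?\<psi> = "\<lambda>g. \<lambda>C \<in> ?E. g <# C"
  have HG: "H \<subseteq> carrier G" using H by (rule subgroup.subset)
  have CG: "C \<subseteq> carrier G" if "C \<in> ?E" for C
    using subgroup.lcosets_carrier[OF H group_axioms that] .
  have closed: "g <# C \<in> ?E" if "g \<in> carrier G" "C \<in> ?E" for g C
    using that HG by (auto simp: LCOSETS_def lcos_m_assoc)
  have comp: "g <# (h <# C) = (g \<otimes> h) <# C" if "g \<in> carrier G" "h \<in> carrier G" "C \<in> ?E" for g h C
    using that CG by (simp add: lcos_m_assoc)
  have one: "\<one> <# C = C" if "C \<in> ?E" for C
    using CG[OF that] by (rule lcos_mult_one)
  have bij: "?\<psi> g \<in> Bij ?E" if g: "g \<in> carrier G" for g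
  proof -
    have "bij_betw (?\<psi> g) ?E ?E"
      by (rule bij_betw_byWitness[where f' = "\<lambda>C. inv g <# C"])
        (use g in \<open>auto simp: closed comp one\<close>)
    then show ?thesis by (simp add: Bij_def)
  qed
  have "?\<psi> (g \<otimes> h) = compose ?E (?\<psi> g) (?\<psi> h)" if "g \<in> carrier G" "h \<in> carrier G" for g h
    using that by (auto simp: compose_def restrict_def fun_eq_iff closed comp)
  then have "?\<psi> \<in> hom G (BijGroup ?E)"
    using bij by (auto simp: hom_def BijGroup_def)
  then show ?thesis
    unfolding group_action_def group_hom_def group_hom_axioms_def
    using group_axioms group_BijGroup by blast
qed

lemma (in group) mem_lcoset_imp_eq:
  assumes H: "subgroup H G" and "C \<in> lcosets H" and "x \<in> C"
  shows "C = x <# H"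
proof -
  obtain a where a: "a \<in> carrier G" "C = a <# H" using assms(2) by (auto simp: LCOSETS_def)
  then show ?thesis using l_repr_independence[OF _ _ H] assms(3) by simp
qed

section \<open>Prime ideals of the ring of invariants\<close>

sublocale ring_action \<subseteq> G: group G
  by (rule group_hom.axioms(1)[OF group_hom])

context ring_action
begin

section \<open>Rules for the action and rings of invariants\<close>

lemma act_ring_hom: "g \<in> carrier G \<Longrightarrow> \<phi> g \<in> ring_hom R R"
  using automorphism by (simp add: ring_iso_def)

lemma act_ring_hom_cring: "g \<in> carrier G \<Longrightarrow> ring_hom_cring R R (\<phi> g)"
  by (intro ring_hom_cringI R.is_cring act_ring_hom)

lemma act_one: "r \<in> carrier R \<Longrightarrow> \<phi> \<one> r = r"
  by (simp flip: id_eq_one)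

lemma act_act: "g \<in> carrier G \<Longrightarrow> h \<in> carrier G \<Longrightarrow> r \<in> carrier R \<Longrightarrow> \<phi> g (\<phi> h r) = \<phi> (g \<otimes> h) r"
  by (simp add: composition_rule)

lemma act_add:
  "g \<in> carrier G \<Longrightarrow> r \<in> carrier R \<Longrightarrow> s \<in> carrier R \<Longrightarrow> \<phi> g (r \<oplus>\<^bsub>R\<^esub> s) = \<phi> g r \<oplus>\<^bsub>R\<^esub> \<phi> g s"
  by (rule ring_hom_add[OF act_ring_hom])

lemma act_mult:
  "g \<in> carrier G \<Longrightarrow> r \<in> carrier R \<Longrightarrow> s \<in> carrier R \<Longrightarrow> \<phi> g (r \<otimes>\<^bsub>R\<^esub> s) = \<phi> g r \<otimes>\<^bsub>R\<^esub> \<phi> g s"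
  by (rule ring_hom_mult[OF act_ring_hom])

lemma act_ring_one: "g \<in> carrier G \<Longrightarrow> \<phi> g \<one>\<^bsub>R\<^esub> = \<one>\<^bsub>R\<^esub>"
  by (rule ring_hom_one[OF act_ring_hom])

lemma act_zero: "g \<in> carrier G \<Longrightarrow> \<phi> g \<zero>\<^bsub>R\<^esub> = \<zero>\<^bsub>R\<^esub>"
  by (rule ring_hom_cring.hom_zero[OF act_ring_hom_cring])

lemma act_a_inv: "g \<in> carrier G \<Longrightarrow> r \<in> carrier R \<Longrightarrow> \<phi> g (\<ominus>\<^bsub>R\<^esub> r) = \<ominus>\<^bsub>R\<^esub> \<phi> g r"
  by (rule ring_hom_cring.hom_a_inv[OF act_ring_hom_cring])

lemma act_finprod:
  "g \<in> carrier G \<Longrightarrow> f \<in> A \<rightarrow> carrier R \<Longrightarrow> \<phi> g (finprod R f A) = (\<Otimes>\<^bsub>R\<^esub>x\<in>A. \<phi> g (f x))"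
  using ring_hom_cring.hom_finprod[OF act_ring_hom_cring] by (simp add: comp_def)

lemma mem_invariant_ring:
  "r \<in> carrier (invariant_ring R \<phi> H) \<longleftrightarrow> r \<in> carrier R \<and> (\<forall>h\<in>H. \<phi> h r = r)"
  by (simp add: invariant_ring_def)

lemma invariant_ring_simps [simp]:
  "a \<otimes>\<^bsub>invariant_ring R \<phi> H\<^esub> b = a \<otimes>\<^bsub>R\<^esub> b" "\<one>\<^bsub>invariant_ring R \<phi> H\<^esub> = \<one>\<^bsub>R\<^esub>"
  "a \<oplus>\<^bsub>invariant_ring R \<phi> H\<^esub> b = a \<oplus>\<^bsub>R\<^esub> b" "\<zero>\<^bsub>invariant_ring R \<phi> H\<^esub> = \<zero>\<^bsub>R\<^esub>"
  by (simp_all add: invariant_ring_def)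

lemma subring_invariants:
  assumes "H \<subseteq> carrier G"
  shows "subring (carrier (invariant_ring R \<phi> H)) R"
  using assms
  by (intro R.subringI)
    (auto simp: mem_invariant_ring subset_iff act_add act_mult act_ring_one act_a_inv)

lemma cring_invariant_ring:
  assumes "H \<subseteq> carrier G"
  shows "cring (invariant_ring R \<phi> H)"
proof -
  have "subcring (carrier (invariant_ring R \<phi> H)) R"
    using subring_invariants[OF assms] by (rule R.subcringI')
  then show ?thesis
    using R.subcring_iff[of "carrier (invariant_ring R \<phi> H)"]
    by (simp add: invariant_ring_def)
qed

text \<open>The preimage of \<open>Q\<close> under \<open>\<phi> g\<close> is the translate of \<open>Q\<close> by the inverse of \<open>g\<close>.\<close>

definition pullback :: "'a \<Rightarrow> 'c set \<Rightarrow> 'c set" where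
  "pullback g Q = {r \<in> carrier R. \<phi> g r \<in> Q}"

lemma primeideal_pullback:
  assumes "g \<in> carrier G" and "primeideal Q R"
  shows "primeideal (pullback g Q) R"
proof -
  interpret ring_hom_cring R R "\<phi> g"
    using assms(1) by (rule act_ring_hom_cring)
  have "ring_hom_ring R R (\<phi> g)"
    using homh by (intro ring_hom_ringI2) (auto intro: R.ring_axioms)
  from ring_hom_ring.primeideal_vimage[OF this R.is_cring assms(2)] show ?thesis
    unfolding pullback_def .
qed

lemma pullback_mono: "Q \<subseteq> Q' \<Longrightarrow> pullback g Q \<subseteq> pullback g Q'"
  by (auto simp: pullback_def)

lemma pullback_one: "Q \<subseteq> carrier R \<Longrightarrow> pullback \<one> Q = Q"
  by (auto simp: pullback_def act_one)

lemma pullback_pullback: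
  "g \<in> carrier G \<Longrightarrow> h \<in> carrier G \<Longrightarrow> pullback g (pullback h Q) = pullback (h \<otimes> g) Q"
  by (auto simp: pullback_def act_act act_closed)

lemma pullback_Int_invariants:
  "g \<in> carrier G \<Longrightarrow>
    pullback g Q \<inter> carrier (invariant_ring R \<phi> (carrier G)) = Q \<inter> carrier (invariant_ring R \<phi> (carrier G))"
  by (auto simp: pullback_def mem_invariant_ring)

text \<open>Iterating the inclusion gives an increasing chain of translates of \<open>Q\<close> by
  powers of \<open>k\<close>. It returns to \<open>Q\<close> at the exponent \<open>order G\<close>,
  so every inclusion in it is an equality.\<close>

lemma pullback_eq_of_subset:
  assumes "finite (carrier G)" and k: "k \<in> carrier G" and Q: "Q \<subseteq> carrier R" and sub: "Q \<subseteq> pullback k Q"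
  shows "pullback k Q = Q"
proof -
  have incr: "Q \<subseteq> pullback (k [^] n) Q" for n :: nat
  proof (induction n)
    case 0
    show ?case using Q by (simp add: pullback_one)
  next
    case (Suc n)
    have "Q \<subseteq> pullback k (pullback (k [^] n) Q)"
      using sub pullback_mono[OF Suc.IH, of k] by (rule subset_trans)
    then show ?case using k by (simp add: pullback_pullback)
  qed
  have "order G > 0"
    using assms(1) G.order_gt_0_iff_finite by blast
  then obtain n where n: "order G = Suc n"
    by (cases "order G") auto
  have "pullback k Q \<subseteq> pullback k (pullback (k [^] n) Q)"
    by (rule pullback_mono[OF incr])
  also have "\<dots> = pullback (k [^] order G) Q"
    using k by (simp add: pullback_pullback n)
  also have "\<dots> = Q"
    using k Q by (simp add: G.pow_order_eq_1 pullback_one)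
  finally show ?thesis using sub by blast
qed

text \<open>Translating back by \<open>inv g\<close> reduces this to
  \<open>pullback_eq_of_subset\<close>. It supplies the incomparability required for prime
  avoidance.\<close>

lemma pullback_eq_of_subset_pullback:
  assumes "finite (carrier G)" and g: "g \<in> carrier G" and h: "h \<in> carrier G" and Q: "Q \<subseteq> carrier R"
    and sub: "pullback g Q \<subseteq> pullback h Q"
  shows "pullback g Q = pullback h Q"
proof -
  have "pullback (inv g) (pullback g Q) \<subseteq> pullback (inv g) (pullback h Q)"
    by (rule pullback_mono[OF sub])
  then have "Q \<subseteq> pullback (h \<otimes> inv g) Q"
    using g h Q by (simp add: pullback_pullback pullback_one)
  then have "pullback (h \<otimes> inv g) Q = Q"
    using assms by (intro pullback_eq_of_subset) auto
  then have "pullback g Q = pullback g (pullback (h \<otimes> inv g) Q)" by simp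
  also have "\<dots> = pullback h Q"
    using g h by (simp add: pullback_pullback G.m_assoc)
  finally show ?thesis .
qed

text \<open>Left multiplication by an element of \<open>H\<close> only permutes the factors. Norms
  over \<open>G\<close> serve to compare primes with their contractions, norms over a
  \<open>p\<close>-subgroup provide arguments for the trace.\<close>

lemma norm_invariant:
  assumes H: "subgroup H G" and r: "r \<in> carrier R"
  shows "(\<Otimes>\<^bsub>R\<^esub>g\<in>H. \<phi> g r) \<in> carrier (invariant_ring R \<phi> H)"
proof -
  interpret H: subgroup H G by fact
  have sub: "H \<subseteq> carrier G" by (rule H.subset)
  then have cl: "(\<lambda>g. \<phi> g r) \<in> H \<rightarrow> carrier R" using r act_closed by auto
  have "\<phi> h (\<Otimes>\<^bsub>R\<^esub>g\<in>H. \<phi> g r) = (\<Otimes>\<^bsub>R\<^esub>g\<in>H. \<phi> g r)" if h: "h \<in> H" for h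
  proof -
    have hG: "h \<in> carrier G" using h sub by auto
    have img: "(\<lambda>g. h \<otimes> g) ` H = H"
    proof
      show "(\<lambda>g. h \<otimes> g) ` H \<subseteq> H" using h by auto
      show "H \<subseteq> (\<lambda>g. h \<otimes> g) ` H"
      proof
        fix x assume x: "x \<in> H"
        then have "h \<otimes> (inv h \<otimes> x) = x"
          using hG sub by (simp add: subset_iff flip: G.m_assoc)
        moreover have "inv h \<otimes> x \<in> H" using h x by simp
        ultimately show "x \<in> (\<lambda>g. h \<otimes> g) ` H" by (metis imageI)
      qed
    qed
    have "\<phi> h (\<Otimes>\<^bsub>R\<^esub>g\<in>H. \<phi> g r) = (\<Otimes>\<^bsub>R\<^esub>g\<in>H. \<phi> h (\<phi> g r))"
      using hG cl by (rule act_finprod)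
    also have "\<dots> = (\<Otimes>\<^bsub>R\<^esub>g\<in>H. \<phi> (h \<otimes> g) r)"
      using hG r sub act_closed by (intro R.finprod_cong') (auto simp: act_act subset_iff)
    also have "\<dots> = (\<Otimes>\<^bsub>R\<^esub>g\<in>(\<lambda>g. h \<otimes> g) ` H. \<phi> g r)"
      using hG sub cl img by (intro R.finprod_reindex[symmetric] inj_onI) (auto simp: subset_iff)
    finally show ?thesis unfolding img .
  qed
  then show ?thesis
    unfolding mem_invariant_ring using cl by simp
qed

section \<open>Contraction of primes to the invariants, and their heights\<close>

lemma primeideal_contraction:
  assumes Q: "primeideal Q R" and H: "H \<subseteq> carrier G"
  shows "primeideal (Q \<inter> carrier (invariant_ring R \<phi> H)) (invariant_ring R \<phi> H)"
proof -
  interpret Q: primeideal Q R by fact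
  have hom: "ring_hom_ring (invariant_ring R \<phi> H) R (\<lambda>x. x)"
    using cring.axioms(1)[OF cring_invariant_ring[OF H]] R.ring_axioms
    by (intro ring_hom_ringI) (auto simp: mem_invariant_ring)
  have "primeideal {r \<in> carrier (invariant_ring R \<phi> H). r \<in> Q} (invariant_ring R \<phi> H)"
    by (rule ring_hom_ring.primeideal_vimage[OF hom cring_invariant_ring[OF H] Q])
  also have "{r \<in> carrier (invariant_ring R \<phi> H). r \<in> Q} = Q \<inter> carrier (invariant_ring R \<phi> H)"
    by auto
  finally show ?thesis .
qed

text \<open>A maximal \<open>G\<close>-stable ideal \<open>J\<close> whose invariants lie in \<open>q\<close> contains \<open>q\<close>: if \<open>a \<in> q\<close> is not in \<open>J\<close>,
  then some invariant \<open>s \<notin> q\<close> is congruent to \<open>r a\<close> modulo \<open>J\<close>, hence to all its conjugates,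
  and multiplying these congruences puts a power of \<open>s\<close> into \<open>q\<close>.\<close>

lemma lying_over:
  assumes fin: "finite (carrier G)"
    and q: "primeideal q (invariant_ring R \<phi> (carrier G))"
  obtains Q where "primeideal Q R" "Q \<inter> carrier (invariant_ring R \<phi> (carrier G)) = q"
proof -
  let ?S = "invariant_ring R \<phi> (carrier G)"
  interpret S: cring ?S by (rule cring_invariant_ring) simp
  interpret q: primeideal q ?S by fact
  have SR: "carrier ?S \<subseteq> carrier R" by (auto simp: mem_invariant_ring)
  have inv: "\<phi> g x = x" if "g \<in> carrier G" "x \<in> carrier ?S" for g x
    using that by (simp add: mem_invariant_ring)
  have "ideal {\<zero>\<^bsub>R\<^esub>} R" by (rule R.zeroideal)
  moreover have "{\<zero>\<^bsub>R\<^esub>} \<inter> (carrier ?S - q) = {}"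
    using q.zero_closed by simp
  moreover have "\<forall>g\<in>carrier G. \<forall>x\<in>{\<zero>\<^bsub>R\<^esub>}. \<phi> g x \<in> {\<zero>\<^bsub>R\<^esub>}"
    by (simp add: act_zero)
  moreover have "\<forall>g\<in>carrier G. \<forall>x\<in>\<Union>C. \<phi> g x \<in> \<Union>C" if "\<And>K. K \<in> C \<Longrightarrow> \<forall>g\<in>carrier G. \<forall>x\<in>K. \<phi> g x \<in> K" for C
    using that by (meson UnionE UnionI)
  ultimately obtain J where J: "ideal J R" "J \<inter> (carrier ?S - q) = {}"
    and stable: "\<forall>g\<in>carrier G. \<forall>x\<in>J. \<phi> g x \<in> J"
    and max: "\<And>K. ideal K R \<Longrightarrow> J \<subseteq> K \<Longrightarrow> K \<inter> (carrier ?S - q) = {} \<Longrightarrow> \<forall>g\<in>carrier G. \<forall>x\<in>K. \<phi> g x \<in> K \<Longrightarrow> K = J"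
    by (rule R.exists_maximal_ideal_satisfying[where \<Phi> = "\<lambda>K. \<forall>g\<in>carrier G. \<forall>x\<in>K. \<phi> g x \<in> K"]) simp_all
  interpret J: ideal J R by fact
  have qJ: "q \<subseteq> J"
  proof
    fix a assume a: "a \<in> q"
    then have aS: "a \<in> carrier ?S" by (rule q.Icarr)
    then have aR: "a \<in> carrier R" using SR by blast
    let ?K = "J <+>\<^bsub>R\<^esub> PIdl\<^bsub>R\<^esub> a"
    note K = R.ideal_add_cgenideal[OF J(1) aR]
    show "a \<in> J"
    proof (rule ccontr)
      assume "a \<notin> J"
      then have "?K \<noteq> J" using K(3) by auto
      moreover have "\<forall>g\<in>carrier G. \<forall>x\<in>?K. \<phi> g x \<in> ?K"
      proof (intro ballI)
        fix g x assume g: "g \<in> carrier G" and "x \<in> ?K"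
        then obtain u r where u: "u \<in> J" and r: "r \<in> carrier R" and x: "x = u \<oplus>\<^bsub>R\<^esub> r \<otimes>\<^bsub>R\<^esub> a"
          using K(4) by metis
        have "\<phi> g x = \<phi> g u \<oplus>\<^bsub>R\<^esub> \<phi> g r \<otimes>\<^bsub>R\<^esub> a"
          using g u r aR aS J.Icarr by (simp add: x act_add act_mult inv)
        moreover have "\<phi> g u \<in> J" "\<phi> g r \<in> carrier R" using g u r stable act_closed by auto
        ultimately show "\<phi> g x \<in> ?K" unfolding K(4) by (intro bexI)
      qed
      ultimately have "?K \<inter> (carrier ?S - q) \<noteq> {}"
        using max[OF K(1,2)] by blast
      then obtain s where s: "s \<in> carrier ?S" "s \<notin> q" "s \<in> ?K" by blast
      then obtain u r where u: "u \<in> J" and r: "r \<in> carrier R" and s_eq: "s = u \<oplus>\<^bsub>R\<^esub> r \<otimes>\<^bsub>R\<^esub> a"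
        using K(4) by metis
      have sR: "s \<in> carrier R" using s SR by blast
      interpret \<pi>: ring_hom_cring R "R Quot J" "(+>\<^bsub>R\<^esub>) J"
        using R.is_cring by (rule J.rcos_ring_hom_cring)
      have cong: "J +>\<^bsub>R\<^esub> s = J +>\<^bsub>R\<^esub> \<phi> g (r \<otimes>\<^bsub>R\<^esub> a)" if g: "g \<in> carrier G" for g
      proof -
        have ra: "\<phi> g (r \<otimes>\<^bsub>R\<^esub> a) \<in> carrier R" and gu: "\<phi> g u \<in> J"
          using g r aR act_closed stable u by auto
        have "s = \<phi> g u \<oplus>\<^bsub>R\<^esub> \<phi> g (r \<otimes>\<^bsub>R\<^esub> a)"
          using inv[OF g s(1)] g u r aR J.Icarr by (simp add: s_eq act_add)
        then have "s \<ominus>\<^bsub>R\<^esub> \<phi> g (r \<otimes>\<^bsub>R\<^esub> a) = \<phi> g u"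
          using ra J.Icarr[OF gu] by (simp add: R.minus_eq R.a_assoc R.r_neg)
        then show ?thesis
          using R.quotient_eq_iff_same_a_r_cos[OF J(1) sR ra] gu by simp
      qed
      define n where "n = card (carrier G)"
      \<comment> \<open>Positivity is needed for the \<open>n\<close>-th power of \<open>a\<close>
        to lie in \<open>q\<close>.\<close>
      have "0 < n" using fin G.one_closed unfolding n_def card_gt_0_iff by blast
      \<comment> \<open>The product of all conjugates of \<open>r a\<close>. Since \<open>a\<close>
        is invariant, it equals the norm of \<open>r\<close> times the \<open>n\<close>-th power of
        \<open>a\<close>, hence it is in \<open>q\<close>.\<close>
      define b where "b = (\<Otimes>\<^bsub>R\<^esub>g\<in>carrier G. \<phi> g (r \<otimes>\<^bsub>R\<^esub> a))"
      define c where "c = (\<Otimes>\<^bsub>R\<^esub>g\<in>carrier G. \<phi> g r)"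
      have cS: "c \<in> carrier ?S"
        unfolding c_def using r G.subgroup_self by (intro norm_invariant)
      have aSn: "a [^]\<^bsub>R\<^esub> m \<in> carrier ?S" for m :: nat
        by (induction m) (use aS S.one_closed S.m_closed in simp_all)
      have aqn: "a [^]\<^bsub>R\<^esub> n \<in> q"
        using \<open>0 < n\<close> q.I_l_closed[OF a aSn, of "n - 1"] by (cases n) simp_all
      have "b = (\<Otimes>\<^bsub>R\<^esub>g\<in>carrier G. \<phi> g r \<otimes>\<^bsub>R\<^esub> a)"
        unfolding b_def using r aR aS act_closed by (intro R.finprod_cong') (auto simp: act_mult inv)
      also have "\<dots> = c \<otimes>\<^bsub>R\<^esub> a [^]\<^bsub>R\<^esub> n"
        unfolding c_def n_def using r aR act_closed
        by (subst R.finprod_multf) (auto simp: R.finprod_const)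
      finally have b: "b = c \<otimes>\<^bsub>R\<^esub> a [^]\<^bsub>R\<^esub> n" .
      then have bq: "b \<in> q" using q.I_l_closed[OF aqn cS] by simp
      have bR: "b \<in> carrier R" using bq q.Icarr SR by blast
      have "J +>\<^bsub>R\<^esub> (s [^]\<^bsub>R\<^esub> n) = J +>\<^bsub>R\<^esub> (\<Otimes>\<^bsub>R\<^esub>g\<in>carrier G. s)"
        using sR by (simp add: R.finprod_const n_def)
      also have "\<dots> = (\<Otimes>\<^bsub>R Quot J\<^esub>g\<in>carrier G. J +>\<^bsub>R\<^esub> s)"
        using sR by (subst \<pi>.hom_finprod) (auto simp: comp_def)
      also have "\<dots> = (\<Otimes>\<^bsub>R Quot J\<^esub>g\<in>carrier G. J +>\<^bsub>R\<^esub> \<phi> g (r \<otimes>\<^bsub>R\<^esub> a))"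
        using r aR act_closed by (intro \<pi>.S.finprod_cong') (simp_all add: cong Pi_def \<pi>.hom_closed)
      also have "\<dots> = J +>\<^bsub>R\<^esub> b"
        unfolding b_def using r aR act_closed by (subst \<pi>.hom_finprod) (auto simp: comp_def)
      finally have "s [^]\<^bsub>R\<^esub> n \<ominus>\<^bsub>R\<^esub> b \<in> J"
        using R.quotient_eq_iff_same_a_r_cos[OF J(1), of "s [^]\<^bsub>R\<^esub> n" b] sR bR by simp
      moreover have sSn: "s [^]\<^bsub>R\<^esub> m \<in> carrier ?S" for m :: nat
        by (induction m) (use s S.one_closed S.m_closed in simp_all)
      have "\<ominus>\<^bsub>R\<^esub> b \<in> carrier ?S"
        using bR q.Icarr[OF bq] by (simp add: mem_invariant_ring act_a_inv)
      then have "s [^]\<^bsub>R\<^esub> n \<ominus>\<^bsub>R\<^esub> b \<in> carrier ?S"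
        using S.a_closed[OF sSn[of n]] by (simp add: R.minus_eq)
      ultimately have "s [^]\<^bsub>R\<^esub> n \<ominus>\<^bsub>R\<^esub> b \<in> q" using J(2) by blast
      then have "(s [^]\<^bsub>R\<^esub> n \<ominus>\<^bsub>R\<^esub> b) \<oplus>\<^bsub>R\<^esub> b \<in> q"
        using q.a_closed[OF _ bq] by simp
      also have "(s [^]\<^bsub>R\<^esub> n \<ominus>\<^bsub>R\<^esub> b) \<oplus>\<^bsub>R\<^esub> b = s [^]\<^bsub>R\<^esub> n"
        using sR bR by (simp add: R.minus_eq R.a_assoc R.l_neg)
      also have "s [^]\<^bsub>R\<^esub> n = s [^]\<^bsub>?S\<^esub> n"
        by (induction n) (simp_all)
      finally show False using q.pow_mem_imp[OF s(1)] s(2) by blast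
    qed
  qed
  \<comment> \<open>As \<open>q \<subseteq> J\<close>, a prime over \<open>J\<close> that avoids the
    invariants outside \<open>q\<close> contracts to exactly \<open>q\<close>.\<close>
  obtain Q where Q: "primeideal Q R" "J \<subseteq> Q" "Q \<inter> (carrier ?S - q) = {}"
  proof (rule R.exists_primeideal_avoiding[OF J(1), of "carrier ?S - q"])
    show "\<one>\<^bsub>R\<^esub> \<in> carrier ?S - q"
      using S.one_closed q.one_imp_carrier q.I_notcarr by auto
    show "s \<otimes>\<^bsub>R\<^esub> t \<in> carrier ?S - q" if "s \<in> carrier ?S - q" "t \<in> carrier ?S - q" for s t
      using that q.I_prime[of s t] S.m_closed[of s t] by auto
  qed (use SR J(2) in auto)
  then show ?thesis using that[of Q] qJ q.a_subset by blast
qed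

text \<open>Otherwise prime avoidance, applied to the translates of \<open>Q'\<close>, yields an
  element of \<open>Q\<close> with no conjugate in \<open>Q'\<close>. Its norm is an invariant that
  lies in \<open>Q\<close> but not in \<open>Q'\<close>.\<close>

lemma contraction_subset_imp:
  assumes fin: "finite (carrier G)" and Q: "primeideal Q R" and Q': "primeideal Q' R"
    and sub: "Q \<inter> carrier (invariant_ring R \<phi> (carrier G)) \<subseteq> Q'"
  obtains g where "g \<in> carrier G" "Q \<subseteq> pullback g Q'"
proof -
  interpret Q: primeideal Q R by fact
  interpret Q': primeideal Q' R by fact
  have "\<exists>P \<in> (\<lambda>g. pullback g Q') ` carrier G. Q \<subseteq> P"
  proof (rule ccontr)
    assume "\<not> ?thesis"
    then have "\<exists>x\<in>Q. \<forall>P \<in> (\<lambda>g. pullback g Q') ` carrier G. x \<notin> P"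
      using fin Q Q' pullback_eq_of_subset_pullback[OF fin _ _ Q'.a_subset]
      by (intro R.prime_avoidance_incomparable)
        (auto simp: primeideal_pullback Q.is_ideal)
    then obtain x where x: "x \<in> Q" "\<And>g. g \<in> carrier G \<Longrightarrow> \<phi> g x \<notin> Q'"
      using Q.Icarr by (auto simp: pullback_def)
    have xR: "x \<in> carrier R" using x Q.Icarr by simp
    define y where "y = (\<Otimes>\<^bsub>R\<^esub>g\<in>carrier G. \<phi> g x)"
    have "y \<in> Q"
      unfolding y_def using fin x xR act_closed
      by (intro Q.finprod_mem[of _ _ \<one>]) (auto simp: act_one R.is_cring)
    moreover have "y \<in> carrier (invariant_ring R \<phi> (carrier G))"
      unfolding y_def using xR G.subgroup_self by (intro norm_invariant)
    ultimately have "y \<in> Q'" using sub by blast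
    then show False
      unfolding y_def using Q'.finprod_mem_imp[OF fin, of "\<lambda>g. \<phi> g x"] x xR act_closed by auto
  qed
  then show ?thesis using that by blast
qed

text \<open>The previous lemma with the two primes exchanged gives
  \<open>Q \<subseteq> Q' \<subseteq> pullback g Q\<close>, and a translate of \<open>Q\<close>
  containing \<open>Q\<close> equals \<open>Q\<close>.\<close>

lemma contraction_incomparable:
  assumes fin: "finite (carrier G)" and Q: "primeideal Q R" and Q': "primeideal Q' R" and "Q \<subseteq> Q'"
    and "Q \<inter> carrier (invariant_ring R \<phi> (carrier G)) = Q' \<inter> carrier (invariant_ring R \<phi> (carrier G))"
  shows "Q = Q'"
proof -
  have sub: "Q \<subseteq> carrier R"
    using Q by (simp add: primeideal.axioms(1) ideal.axioms(1) additive_subgroup.a_subset)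
  obtain g where g: "g \<in> carrier G" "Q' \<subseteq> pullback g Q"
    using contraction_subset_imp[OF fin Q' Q] assms(5) by blast
  then have "pullback g Q = Q"
    using assms(4) by (intro pullback_eq_of_subset[OF fin _ sub]) auto
  then show ?thesis using g assms(4) by auto
qed

text \<open>Any prime over \<open>q'\<close> lies in some translate of \<open>Q\<close>; the inverse
  translation moves it into \<open>Q\<close> without changing its contraction.\<close>

lemma going_down:
  assumes fin: "finite (carrier G)" and Q: "primeideal Q R"
    and q': "primeideal q' (invariant_ring R \<phi> (carrier G))" and sub: "q' \<subseteq> Q"
  obtains Q' where "primeideal Q' R" "Q' \<subseteq> Q" "Q' \<inter> carrier (invariant_ring R \<phi> (carrier G)) = q'"
proof -
  have QR: "Q \<subseteq> carrier R"
    using Q by (simp add: primeideal.axioms(1) ideal.axioms(1) additive_subgroup.a_subset)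
  obtain P where P: "primeideal P R" "P \<inter> carrier (invariant_ring R \<phi> (carrier G)) = q'"
    using lying_over[OF fin q'] by blast
  obtain g where g: "g \<in> carrier G" "P \<subseteq> pullback g Q"
    using contraction_subset_imp[OF fin P(1) Q] P(2) sub by blast
  show ?thesis
  proof (rule that)
    show "primeideal (pullback (inv g) P) R"
      using g P(1) by (simp add: primeideal_pullback)
    have "pullback (inv g) P \<subseteq> pullback (inv g) (pullback g Q)"
      by (rule pullback_mono[OF g(2)])
    then show "pullback (inv g) P \<subseteq> Q"
      using g QR by (simp add: pullback_pullback pullback_one)
    show "pullback (inv g) P \<inter> carrier (invariant_ring R \<phi> (carrier G)) = q'"
      using g P(2) by (simp add: pullback_Int_invariants)
  qed
qed

text \<open>The chain is lifted from the top downwards by \<open>going_down\<close>. It stays strict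
  because consecutive lifts have different contractions.\<close>

lemma lift_prime_chain:
  assumes fin: "finite (carrier G)"
    and "primeideal Q R" and "\<forall>i\<le>n. primeideal (C i) (invariant_ring R \<phi> (carrier G))"
    and "\<forall>i<n. C i \<subset> C (Suc i)" and "C n = Q \<inter> carrier (invariant_ring R \<phi> (carrier G))"
  shows "\<exists>D :: nat \<Rightarrow> 'c set. (\<forall>i\<le>n. primeideal (D i) R) \<and> (\<forall>i<n. D i \<subset> D (Suc i)) \<and> D n = Q"
  using assms(2-)
proof (induction n arbitrary: Q)
  case 0
  then show ?case by (intro exI[of _ "\<lambda>_. Q"]) simp
next
  case (Suc n)
  have lt: "C n \<subset> Q \<inter> carrier (invariant_ring R \<phi> (carrier G))" using Suc.prems(3,4) by auto
  obtain Q' where Q': "primeideal Q' R" "Q' \<subseteq> Q" "Q' \<inter> carrier (invariant_ring R \<phi> (carrier G)) = C n"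
    using going_down[OF fin Suc.prems(1), of "C n"] Suc.prems(2) lt by auto
  obtain D where D: "\<forall>i\<le>n. primeideal (D i) R" "\<forall>i<n. D i \<subset> D (Suc i)" "D n = Q'"
    using Suc.IH[OF Q'(1)] Suc.prems(2,3) Q'(3) by auto
  have "Q' \<noteq> Q" using lt Q'(3) by blast
  then show ?case
    using D Q' Suc.prems(1)
    by (intro exI[of _ "D(Suc n := Q)"]) (auto simp: le_Suc_eq less_Suc_eq)
qed

text \<open>Chains of invariant primes lift with the same length; conversely a chain ending in
  \<open>Q\<close> contracts to one that remains strict by
  \<open>contraction_incomparable\<close>.\<close>

lemma prime_height_contraction:
  assumes fin: "finite (carrier G)" and Q: "primeideal Q R"
  shows "prime_height (invariant_ring R \<phi> (carrier G)) (Q \<inter> carrier (invariant_ring R \<phi> (carrier G))) =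
    prime_height R Q"
proof -
  let ?S = "invariant_ring R \<phi> (carrier G)"
  have "(\<exists>C :: nat \<Rightarrow> 'c set. (\<forall>i\<le>n. primeideal (C i) ?S) \<and> (\<forall>i<n. C i \<subset> C (Suc i)) \<and> C n = Q \<inter> carrier ?S)
    \<longleftrightarrow> (\<exists>D :: nat \<Rightarrow> 'c set. (\<forall>i\<le>n. primeideal (D i) R) \<and> (\<forall>i<n. D i \<subset> D (Suc i)) \<and> D n = Q)" for n
  proof
    assume "\<exists>C :: nat \<Rightarrow> 'c set. (\<forall>i\<le>n. primeideal (C i) ?S) \<and> (\<forall>i<n. C i \<subset> C (Suc i)) \<and> C n = Q \<inter> carrier ?S"
    then show "\<exists>D :: nat \<Rightarrow> 'c set. (\<forall>i\<le>n. primeideal (D i) R) \<and> (\<forall>i<n. D i \<subset> D (Suc i)) \<and> D n = Q"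
      using lift_prime_chain[OF fin Q] by blast
  next
    assume "\<exists>D :: nat \<Rightarrow> 'c set. (\<forall>i\<le>n. primeideal (D i) R) \<and> (\<forall>i<n. D i \<subset> D (Suc i)) \<and> D n = Q"
    then obtain D :: "nat \<Rightarrow> 'c set" where
      D: "\<And>i. i \<le> n \<Longrightarrow> primeideal (D i) R" "\<And>i. i < n \<Longrightarrow> D i \<subset> D (Suc i)" "D n = Q"
      by blast
    have "D i \<inter> carrier ?S \<subset> D (Suc i) \<inter> carrier ?S" if "i < n" for i
    proof -
      have "D i \<inter> carrier ?S \<noteq> D (Suc i) \<inter> carrier ?S"
        using contraction_incomparable[OF fin D(1) D(1), of i "Suc i"] D(2)[OF that] that by auto
      then show ?thesis using D(2)[OF that] by blast
    qed
    then show "\<exists>C :: nat \<Rightarrow> 'c set. (\<forall>i\<le>n. primeideal (C i) ?S) \<and> (\<forall>i<n. C i \<subset> C (Suc i)) \<and> C n = Q \<inter> carrier ?S"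
      using D by (intro exI[of _ "\<lambda>i. D i \<inter> carrier ?S"]) (auto intro: primeideal_contraction)
  qed
  then show ?thesis unfolding prime_height_def by simp
qed

end

section \<open>Relative traces modulo a prime ideal\<close>

context ring_action
begin

section \<open>Inertia groups and augmentation ideals\<close>

definition inertia_group :: "'c set \<Rightarrow> 'a set" where
  "inertia_group Q = {g \<in> carrier G. \<forall>r\<in>carrier R. \<phi> g r \<ominus>\<^bsub>R\<^esub> r \<in> Q}"

lemma inertia_group_iff:
  assumes "ideal Q R" and "g \<in> carrier G"
  shows "g \<in> inertia_group Q \<longleftrightarrow> (\<forall>r\<in>carrier R. Q +>\<^bsub>R\<^esub> \<phi> g r = Q +>\<^bsub>R\<^esub> r)"
  unfolding inertia_group_def
  using assms(2) R.quotient_eq_iff_same_a_r_cos[OF assms(1)] act_closed by simp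

lemma subgroup_inertia_group:
  assumes Q: "ideal Q R"
  shows "subgroup (inertia_group Q) G"
proof (rule G.subgroupI)
  show sub: "inertia_group Q \<subseteq> carrier G" by (auto simp: inertia_group_def)
  have "\<one> \<in> inertia_group Q" by (simp add: inertia_group_iff[OF Q] act_one)
  then show "inertia_group Q \<noteq> {}" by blast
  have *: "Q +>\<^bsub>R\<^esub> \<phi> g r = Q +>\<^bsub>R\<^esub> r" if "g \<in> inertia_group Q" "r \<in> carrier R" for g r
    using that sub inertia_group_iff[OF Q] by blast
  show "inv g \<in> inertia_group Q" if g: "g \<in> inertia_group Q" for g
  proof -
    have gG: "g \<in> carrier G" using g sub by blast
    have "Q +>\<^bsub>R\<^esub> \<phi> (inv g) r = Q +>\<^bsub>R\<^esub> r" if "r \<in> carrier R" for r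
      using *[OF g act_closed[of "inv g" r]] gG that by (simp add: act_act act_one)
    then show ?thesis using gG by (simp add: inertia_group_iff[OF Q])
  qed
  show "g \<otimes> h \<in> inertia_group Q" if g: "g \<in> inertia_group Q" and h: "h \<in> inertia_group Q" for g h
  proof -
    have G: "g \<in> carrier G" "h \<in> carrier G" using g h sub by auto
    have "Q +>\<^bsub>R\<^esub> \<phi> (g \<otimes> h) r = Q +>\<^bsub>R\<^esub> r" if "r \<in> carrier R" for r
      using *[OF g act_closed[OF G(2) that]] *[OF h that] G that by (simp flip: act_act)
    then show ?thesis using G by (simp add: inertia_group_iff[OF Q])
  qed
qed

lemma augmentation_ideal_subset_iff:
  assumes "ideal Q R" and "H \<subseteq> carrier G"
  shows "augmentation_ideal R \<phi> H \<subseteq> Q \<longleftrightarrow> H \<subseteq> inertia_group Q"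
proof -
  let ?X = "{\<phi> h r \<ominus>\<^bsub>R\<^esub> r | h r. h \<in> H \<and> r \<in> carrier R}"
  have X: "?X \<subseteq> carrier R" using assms(2) act_closed by blast
  have "augmentation_ideal R \<phi> H \<subseteq> Q \<longleftrightarrow> ?X \<subseteq> Q"
    unfolding augmentation_ideal_def
    using R.genideal_minimal[OF assms(1)] R.genideal_self[OF X] by blast
  also have "\<dots> \<longleftrightarrow> H \<subseteq> inertia_group Q"
    using assms(2) unfolding inertia_group_def by blast
  finally show ?thesis .
qed

section \<open>Coset representatives and invariance of the relative trace\<close>

lemma coset_rep_mem:
  assumes H: "subgroup H G" and C: "C \<in> lcosets H"
  shows "(SOME g. g \<in> C) \<in> C" "(SOME g. g \<in> C) \<in> carrier G" "C = (SOME g. g \<in> C) <# H"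
proof -
  obtain a where "a \<in> carrier G" "C = a <# H" using C by (auto simp: LCOSETS_def)
  then have "a \<in> C" using G.lcos_self H by simp
  then show mem: "(SOME g. g \<in> C) \<in> C" by (rule someI)
  then show "(SOME g. g \<in> C) \<in> carrier G"
    using subgroup.lcosets_carrier[OF H G.group_axioms C] by blast
  show "C = (SOME g. g \<in> C) <# H"
    using H C mem by (rule G.mem_lcoset_imp_eq)
qed

lemma act_coset_rep:
  assumes H: "subgroup H G" and r: "r \<in> carrier (invariant_ring R \<phi> H)" and a: "a \<in> carrier G"
  shows "\<phi> (SOME g. g \<in> a <# H) r = \<phi> a r"
proof -
  have C: "a <# H \<in> lcosets H" using a by (auto simp: LCOSETS_def)
  obtain h where h: "h \<in> H" "(SOME g. g \<in> a <# H) = a \<otimes> h"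
    using coset_rep_mem(1)[OF H C] by (auto simp: l_coset_def)
  have "h \<in> carrier G" using h(1) subgroup.subset[OF H] by blast
  then show ?thesis
    using h r a act_act[of a h r] by (simp add: mem_invariant_ring)
qed

text \<open>The chosen representative of \<open>x <# C\<close> need not be \<open>x\<close> times
  that of \<open>C\<close>, but the two differ by a right factor in \<open>H\<close>, which fixes
  \<open>r\<close>.\<close>

lemma act_coset_rep_translate:
  assumes H: "subgroup H G" and r: "r \<in> carrier (invariant_ring R \<phi> H)"
    and x: "x \<in> carrier G" and C: "C \<in> lcosets H"
  shows "\<phi> (SOME g. g \<in> x <# C) r = \<phi> x (\<phi> (SOME g. g \<in> C) r)"
proof -
  obtain a where a: "a \<in> carrier G" "C = a <# H" using C by (auto simp: LCOSETS_def)
  have "x <# C = (x \<otimes> a) <# H"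
    unfolding a(2) using subgroup.subset[OF H] x a(1) by (rule G.lcos_m_assoc)
  then show ?thesis
    using act_coset_rep[OF H r, of "x \<otimes> a"] act_coset_rep[OF H r a(1)] x a r
    by (simp add: act_act mem_invariant_ring)
qed

text \<open>An element of \<open>G\<close> permutes the left cosets, and by
  \<open>act_coset_rep_translate\<close> the summands are permuted along with them.\<close>

lemma rel_trace_invariant:
  assumes H: "subgroup H G" and r: "r \<in> carrier (invariant_ring R \<phi> H)"
  shows "rel_trace G R \<phi> H r \<in> carrier (invariant_ring R \<phi> (carrier G))"
proof -
  let ?v = "\<lambda>C. \<phi> (SOME g. g \<in> C) r"
  have rR: "r \<in> carrier R" using r by (simp add: mem_invariant_ring)
  have v: "?v \<in> lcosets H \<rightarrow> carrier R"
    using coset_rep_mem(2)[OF H] rR act_closed by auto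
  interpret act: group_action G "lcosets H" "\<lambda>g. \<lambda>C \<in> lcosets H. g <# C"
    using H by (rule G.action_on_lcosets)
  have "\<phi> g (rel_trace G R \<phi> H r) = rel_trace G R \<phi> H r" if g: "g \<in> carrier G" for g
  proof -
    let ?s = "\<lambda>C \<in> lcosets H. g <# C"
    have img: "?s ` (lcosets H) = lcosets H" using g by (rule act.surj_prop)
    have "\<phi> g (\<Oplus>\<^bsub>R\<^esub>C\<in>lcosets H. ?v C) = (\<Oplus>\<^bsub>R\<^esub>C\<in>lcosets H. \<phi> g (?v C))"
      using ring_hom_cring.hom_finsum[OF act_ring_hom_cring[OF g] v] by (simp add: comp_def)
    also have "\<dots> = (\<Oplus>\<^bsub>R\<^esub>C\<in>lcosets H. ?v (?s C))"
      using v g act_closed act_coset_rep_translate[OF H r g]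
      by (intro R.finsum_cong') (auto simp: Pi_def)
    also have "\<dots> = (\<Oplus>\<^bsub>R\<^esub>C\<in>?s ` (lcosets H). ?v C)"
      by (rule R.finsum_reindex[symmetric]) (use v act.inj_prop[OF g] in \<open>simp_all only: img\<close>)
    finally show ?thesis unfolding rel_trace_def img .
  qed
  then show ?thesis
    using v by (simp add: mem_invariant_ring rel_trace_def)
qed

text \<open>Modulo \<open>Q\<close>, the summands of the trace are constant on the orbits of \<open>P\<close> on \<open>G/H\<close>,
  and a fixed point \<open>aH\<close> would mean that \<open>P\<close> is contained in \<open>a H a\<^sup>-\<^sup>1\<close>.\<close>

lemma trace_ideal_subset:
  assumes fin: "finite (carrier G)" and Q: "primeideal Q R"
    and p: "Factorial_Ring.prime (p::nat)" and char: "[p] \<cdot>\<^bsub>R\<^esub> \<one>\<^bsub>R\<^esub> = \<zero>\<^bsub>R\<^esub>"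
    and P: "subgroup P G" "card P = p ^ k" "P \<subseteq> inertia_group Q"
    and H: "subgroup H G" and nsub: "\<And>a. a \<in> carrier G \<Longrightarrow> \<not> P \<subseteq> a <# H #> inv a"
  shows "trace_ideal G R \<phi> H \<subseteq> Q"
proof
  fix y assume "y \<in> trace_ideal G R \<phi> H"
  then obtain r where r: "r \<in> carrier (invariant_ring R \<phi> H)" and y: "y = rel_trace G R \<phi> H r"
    by (auto simp: trace_ideal_def)
  interpret Q: primeideal Q R by fact
  interpret \<pi>: ring_hom_cring R "R Quot Q" "(+>\<^bsub>R\<^esub>) Q"
    by (rule Q.rcos_ring_hom_cring)
  let ?v = "\<lambda>C. \<phi> (SOME g. g \<in> C) r"
  have rR: "r \<in> carrier R" using r by (simp add: mem_invariant_ring)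
  have v: "?v \<in> lcosets H \<rightarrow> carrier R"
    using coset_rep_mem(2)[OF H] rR act_closed by auto
  have PG: "P \<subseteq> carrier G" using P(1) by (rule subgroup.subset)
  have \<pi>_char: "[p] \<cdot>\<^bsub>R Quot Q\<^esub> \<one>\<^bsub>R Quot Q\<^esub> = \<zero>\<^bsub>R Quot Q\<^esub>"
    using R.is_cring char by (rule Q.quotient_char)
  interpret act: group_action G "lcosets H" "\<lambda>g. \<lambda>C \<in> lcosets H. g <# C"
    using H by (rule G.action_on_lcosets)
  have "Q +>\<^bsub>R\<^esub> y = (\<Oplus>\<^bsub>R Quot Q\<^esub>C\<in>lcosets H. Q +>\<^bsub>R\<^esub> ?v C)"
    unfolding y rel_trace_def using \<pi>.hom_finsum[OF v] by (simp add: comp_def)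
  also have "\<dots> = \<zero>\<^bsub>R Quot Q\<^esub>"
  proof (rule \<pi>.S.finsum_eq_zero_of_p_group_action[OF act.induced_action[OF P(1)] _ p, of k])
    show "finite (lcosets H)"
      using fin by (auto simp: LCOSETS_def)
    show "order (G\<lparr>carrier := P\<rparr>) = p ^ k" using P(2) by (simp add: order_def)
    show "[p] \<cdot>\<^bsub>R Quot Q\<^esub> x = \<zero>\<^bsub>R Quot Q\<^esub>" if "x \<in> carrier (R Quot Q)" for x
      using \<pi>.S.add_pow_eq_zero[OF \<pi>_char _ that] by simp
    show "(\<lambda>C. Q +>\<^bsub>R\<^esub> ?v C) \<in> lcosets H \<rightarrow> carrier (R Quot Q)"
      using v by auto
    show "Q +>\<^bsub>R\<^esub> ?v ((\<lambda>C\<in>lcosets H. g <# C) C) = Q +>\<^bsub>R\<^esub> ?v C"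
      if g: "g \<in> carrier (G\<lparr>carrier := P\<rparr>)" and C: "C \<in> lcosets H" for g C
    proof -
      have gP: "g \<in> P" "g \<in> carrier G" using g PG by auto
      have "Q +>\<^bsub>R\<^esub> \<phi> g (?v C) = Q +>\<^bsub>R\<^esub> ?v C"
        using inertia_group_iff[OF Q.is_ideal gP(2)] P(3) gP(1) v C by blast
      then show ?thesis
        using act_coset_rep_translate[OF H r gP(2) C] C by simp
    qed
    show "\<exists>g\<in>carrier (G\<lparr>carrier := P\<rparr>). (\<lambda>C\<in>lcosets H. g <# C) C \<noteq> C" if C: "C \<in> lcosets H" for C
    proof (rule ccontr)
      assume *: "\<not> ?thesis"
      obtain a where a: "a \<in> carrier G" "C = a <# H" using C by (auto simp: LCOSETS_def)
      have "g \<in> a <# H #> inv a" if g: "g \<in> P" for g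
      proof -
        have gG: "g \<in> carrier G" using g PG by blast
        have "g <# C = C" using * g C by auto
        moreover have "a \<in> C" using a H by (simp add: G.lcos_self)
        then have "g \<otimes> a \<in> g <# C" unfolding l_coset_def by blast
        ultimately have "g \<otimes> a \<in> a <# H" by (simp only: a(2))
        moreover have "g = (g \<otimes> a) \<otimes> inv a" using gG a(1) by (simp add: G.m_assoc)
        ultimately show ?thesis unfolding r_coset_def by blast
      qed
      then show False using nsub[OF a(1)] by blast
    qed
  qed
  finally have "Q +>\<^bsub>R\<^esub> y = \<zero>\<^bsub>R Quot Q\<^esub>" .
  moreover have "y \<in> carrier R"
    unfolding y rel_trace_def using v by (rule R.finsum_closed)
  ultimately show "y \<in> Q" by (simp only: Q.rcos_eq_zero_iff)
qed

text \<open>Since \<open>P \<subseteq> T\<close>, a chosen representative lies in \<open>T\<close>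
  exactly when its whole coset does. These are therefore the cosets of \<open>P\<close> in
  \<open>T\<close>, and Lagrange's theorem applies.\<close>

lemma card_lcosets_meeting_subgroup:
  assumes fin: "finite (carrier G)" and T: "subgroup T G" and P: "subgroup P G" "P \<subseteq> T"
  shows "card {C \<in> lcosets P. (SOME g. g \<in> C) \<in> T} * card P = card T"
proof -
  interpret T: group "G\<lparr>carrier := T\<rparr>" using T by (rule subgroup.subgroup_is_group) (rule G.group_axioms)
  have TG: "T \<subseteq> carrier G" using T by (rule subgroup.subset)
  have "{C \<in> lcosets P. (SOME g. g \<in> C) \<in> T} = lcosets\<^bsub>G\<lparr>carrier := T\<rparr>\<^esub> P"
  proof (intro subset_antisym subsetI)
    fix C assume "C \<in> {C \<in> lcosets P. (SOME g. g \<in> C) \<in> T}"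
    then show "C \<in> lcosets\<^bsub>G\<lparr>carrier := T\<rparr>\<^esub> P"
      using coset_rep_mem(3)[OF P(1), of C] by (auto simp: LCOSETS_def l_coset_def)
  next
    fix C assume "C \<in> lcosets\<^bsub>G\<lparr>carrier := T\<rparr>\<^esub> P"
    then obtain a where a: "a \<in> T" "C = a <# P" by (auto simp: LCOSETS_def l_coset_def)
    then have C: "C \<in> lcosets P" using TG by (auto simp: LCOSETS_def)
    obtain h where "h \<in> P" "(SOME g. g \<in> C) = a \<otimes> h"
      using coset_rep_mem(1)[OF P(1) C] a(2) by (auto simp: l_coset_def)
    then show "C \<in> {C \<in> lcosets P. (SOME g. g \<in> C) \<in> T}"
      using C a(1) P(2) subgroup.m_closed[OF T] by auto
  qed
  moreover have "card (lcosets\<^bsub>G\<lparr>carrier := T\<rparr>\<^esub> P) * card P = order (G\<lparr>carrier := T\<rparr>)"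
    using finite_subset[OF TG fin] G.subgroup_incl[OF P(1) T P(2)] by (intro T.l_lagrange) simp_all
  ultimately show ?thesis by (simp add: order_def)
qed

text \<open>Choose \<open>a \<notin> Q\<close> lying in all translates of \<open>Q\<close> not contained in \<open>Q\<close>. Modulo \<open>Q\<close>, the \<open>P\<close>-norm
  \<open>r\<close> of \<open>a b\<close> satisfies \<open>t r = (t a)\<^sup>q (t b)\<^sup>q\<close> with \<open>q = |P|\<close> for every \<open>t\<close>, so its trace
  is the \<open>q\<close>-th power of the sum of \<open>(t a) (t b)\<close>. If this vanished for all \<open>b\<close>, independence of characters would make
  the sum of \<open>t a\<close> over the cosets inside the inertia group, which is \<open>m a\<close>, vanish.\<close>

lemma trace_ideal_not_subset:
  assumes fin: "finite (carrier G)" and Q: "primeideal Q R"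
    and p: "Factorial_Ring.prime (p::nat)" and char: "[p] \<cdot>\<^bsub>R\<^esub> \<one>\<^bsub>R\<^esub> = \<zero>\<^bsub>R\<^esub>"
    and P: "subgroup P G" "card P = p ^ k" "P \<subseteq> inertia_group Q"
    and m: "card (inertia_group Q) = p ^ k * m" "\<not> p dvd m"
  shows "\<not> trace_ideal G R \<phi> P \<subseteq> Q"
proof
  assume sub: "trace_ideal G R \<phi> P \<subseteq> Q"
  interpret Q: primeideal Q R by fact
  interpret K: domain "R Quot Q" by (rule Q.quotient_is_domain)
  interpret P: subgroup P G by fact
  let ?K = "R Quot Q" and ?t = "\<lambda>C. SOME g. g \<in> C"
  define \<pi> where "\<pi> r = Q +>\<^bsub>R\<^esub> r" for r
  have \<pi>_hom: "ring_hom_cring R ?K \<pi>"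
    unfolding \<pi>_def[abs_def] by (rule Q.rcos_ring_hom_cring)
  note \<pi>_ring_hom = ring_hom_cring.homh[OF \<pi>_hom]
  have \<pi>_closed: "\<pi> r \<in> carrier ?K" if "r \<in> carrier R" for r
    using ring_hom_closed[OF \<pi>_ring_hom that] .
  have \<pi>_mult: "\<pi> (r \<otimes>\<^bsub>R\<^esub> s) = \<pi> r \<otimes>\<^bsub>?K\<^esub> \<pi> s" if "r \<in> carrier R" "s \<in> carrier R" for r s
    using ring_hom_mult[OF \<pi>_ring_hom that] .
  have \<pi>_zero: "\<pi> r = \<zero>\<^bsub>?K\<^esub> \<longleftrightarrow> r \<in> Q" if "r \<in> carrier R" for r
    unfolding \<pi>_def using that by (rule Q.rcos_eq_zero_iff)
  have \<pi>_eq: "\<pi> r = \<pi> s \<longleftrightarrow> r \<ominus>\<^bsub>R\<^esub> s \<in> Q" if "r \<in> carrier R" "s \<in> carrier R" for r s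
    unfolding \<pi>_def using R.quotient_eq_iff_same_a_r_cos[OF Q.is_ideal that] by simp
  have K_char: "[p] \<cdot>\<^bsub>?K\<^esub> \<one>\<^bsub>?K\<^esub> = \<zero>\<^bsub>?K\<^esub>"
    using R.is_cring char by (rule Q.quotient_char)
  have PG: "P \<subseteq> carrier G" by (rule P.subset)
  have finP: "finite P" using finite_subset[OF PG fin] .
  have finL: "finite (lcosets P)" using fin by (simp add: LCOSETS_def)
  have T: "subgroup (inertia_group Q) G" using Q.is_ideal by (rule subgroup_inertia_group)
  have tG: "?t C \<in> carrier G" if "C \<in> lcosets P" for C
    using coset_rep_mem(2)[OF P(1) that] .
  have inertia: "\<pi> (\<phi> g r) = \<pi> r" if "g \<in> inertia_group Q" "r \<in> carrier R" for g r
    using that inertia_group_iff[OF Q.is_ideal, of g] unfolding \<pi>_def inertia_group_def by auto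

  have "\<exists>a\<in>carrier R. a \<notin> Q \<and> (\<forall>I \<in> (\<lambda>g. pullback g Q) ` {g \<in> carrier G. \<not> pullback g Q \<subseteq> Q}. a \<in> I)"
  proof (rule R.exists_in_ideals_not_in_primeideal)
    show "ideal I R" if "I \<in> (\<lambda>g. pullback g Q) ` {g \<in> carrier G. \<not> pullback g Q \<subseteq> Q}" for I
      using that primeideal_pullback[OF _ Q] by (auto dest: primeideal.axioms(1))
  qed (use fin Q in auto)
  then obtain a where a: "a \<in> carrier R" "a \<notin> Q"
    and aI: "\<forall>I \<in> (\<lambda>g. pullback g Q) ` {g \<in> carrier G. \<not> pullback g Q \<subseteq> Q}. a \<in> I"
    by (elim bexE conjE)
  \<comment> \<open>A translate contained in \<open>Q\<close> equals \<open>Q\<close> because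
    \<open>G\<close> is finite; every other translate contains \<open>a\<close> by the choice of
    \<open>a\<close>.\<close>
  have a_dich: "pullback g Q = Q \<or> \<phi> g a \<in> Q" if g: "g \<in> carrier G" for g
  proof (cases "pullback g Q \<subseteq> Q")
    case True
    then have "pullback g Q = pullback \<one> Q"
      by (intro pullback_eq_of_subset_pullback[OF fin g G.one_closed Q.a_subset])
        (simp only: pullback_one[OF Q.a_subset])
    then show ?thesis by (simp only: pullback_one[OF Q.a_subset] simp_thms)
  next
    case False
    then have "a \<in> pullback g Q" using aI g by blast
    then show ?thesis by (simp add: pullback_def)
  qed

  define N where "N r = (\<Otimes>\<^bsub>R\<^esub>x\<in>P. \<phi> x r)" for r
  have N_inv: "N r \<in> carrier (invariant_ring R \<phi> P)" if "r \<in> carrier R" for r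
    unfolding N_def using P(1) that by (rule norm_invariant)
  have N_closed: "N r \<in> carrier R" if "r \<in> carrier R" for r
    using N_inv[OF that] by (simp add: mem_invariant_ring)
  \<comment> \<open>If \<open>g\<close> preserves \<open>Q\<close>, all \<open>p ^ k\<close> factors
    of the norm have the same class, as \<open>P\<close> acts trivially modulo \<open>Q\<close>,
    which is then its own preimage under \<open>\<phi> g\<close>. Otherwise
    \<open>\<phi> g a\<close> is in \<open>Q\<close> and both sides vanish.\<close>
  have N_power: "\<pi> (\<phi> g (N (a \<otimes>\<^bsub>R\<^esub> b))) = \<pi> (\<phi> g (a \<otimes>\<^bsub>R\<^esub> b)) [^]\<^bsub>?K\<^esub> (p ^ k)"
    if g: "g \<in> carrier G" and b: "b \<in> carrier R" for g b
  proof -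
    let ?r = "a \<otimes>\<^bsub>R\<^esub> b"
    have r: "?r \<in> carrier R" using a b by simp
    have cl: "\<phi> g (\<phi> x ?r) \<in> carrier R" if "x \<in> P" for x
      using that PG g r by (intro act_closed) auto
    have "\<phi> g (N ?r) = (\<Otimes>\<^bsub>R\<^esub>x\<in>P. \<phi> g (\<phi> x ?r))"
      unfolding N_def using g r PG by (intro act_finprod) (auto intro: act_closed)
    then have *: "\<pi> (\<phi> g (N ?r)) = (\<Otimes>\<^bsub>?K\<^esub>x\<in>P. \<pi> (\<phi> g (\<phi> x ?r)))"
      using ring_hom_cring.hom_finprod[OF \<pi>_hom, of "\<lambda>x. \<phi> g (\<phi> x ?r)" P] cl by (simp add: comp_def)
    show ?thesis
    proof (cases "pullback g Q = Q")
      case True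
      have "\<pi> (\<phi> g (\<phi> x ?r)) = \<pi> (\<phi> g ?r)" if x: "x \<in> P" for x
      proof -
        have xr: "\<phi> x ?r \<in> carrier R" using x PG r by (intro act_closed) auto
        have "\<phi> x ?r \<ominus>\<^bsub>R\<^esub> ?r \<in> pullback g Q"
          unfolding True using x P(3) r by (auto simp: inertia_group_def)
        then have "\<phi> g (\<phi> x ?r) \<ominus>\<^bsub>R\<^esub> \<phi> g ?r \<in> Q"
          using g xr r by (simp add: pullback_def R.minus_eq act_add act_a_inv)
        then show ?thesis by (simp only: \<pi>_eq[OF cl[OF x] act_closed[OF g r]])
      qed
      then have "\<pi> (\<phi> g (N ?r)) = (\<Otimes>\<^bsub>?K\<^esub>x\<in>P. \<pi> (\<phi> g ?r))"
        unfolding * using \<pi>_closed[OF act_closed[OF g r]] by (intro K.finprod_cong') auto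
      also have "\<dots> = \<pi> (\<phi> g ?r) [^]\<^bsub>?K\<^esub> card P"
        using \<pi>_closed[OF act_closed[OF g r]] by (rule K.finprod_const)
      finally show ?thesis using P(2) by simp
    next
      case False
      then have "\<phi> g a \<in> Q" using a_dich[OF g] by blast
      then have "\<phi> g ?r \<in> Q"
        using g a(1) b act_closed[OF g b] by (simp add: act_mult Q.I_r_closed)
      then have 0: "\<pi> (\<phi> g ?r) = \<zero>\<^bsub>?K\<^esub>" by (simp only: \<pi>_zero[OF act_closed[OF g r]])
      \<comment> \<open>The factor at the unit of \<open>P\<close> is already zero. The power on the
        other side is zero too, since \<open>p ^ k\<close> is positive.\<close>
      have "(\<Otimes>\<^bsub>?K\<^esub>x\<in>P. \<pi> (\<phi> g (\<phi> x ?r))) \<in> {\<zero>\<^bsub>?K\<^esub>}"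
        using finP P.one_closed cl \<pi>_closed r 0
        by (intro ideal.finprod_mem[OF K.zeroideal K.is_cring, of _ _ \<one>]) (auto simp: act_one)
      moreover have "0 < p ^ k" using prime_gt_0_nat[OF p] by simp
      ultimately show ?thesis using * 0 by (simp add: K.nat_pow_zero)
    qed
  qed

  \<comment> \<open>Frobenius makes the class of the trace of \<open>N (a b)\<close>, which is in
    \<open>Q\<close> by assumption, the \<open>p ^ k\<close>-th power of this sum. In a domain a
    vanishing power has a vanishing base.\<close>
  have sum_zero: "(\<Oplus>\<^bsub>?K\<^esub>C\<in>lcosets P. \<pi> (\<phi> (?t C) a) \<otimes>\<^bsub>?K\<^esub> \<pi> (\<phi> (?t C) b)) = \<zero>\<^bsub>?K\<^esub>"
    if b: "b \<in> carrier R" for b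
  proof -
    let ?r = "a \<otimes>\<^bsub>R\<^esub> b"
    have r: "?r \<in> carrier R" using a b by simp
    have cl: "(\<lambda>C. \<phi> (?t C) s) \<in> lcosets P \<rightarrow> carrier R" if "s \<in> carrier R" for s
      using that tG by (intro Pi_I act_closed)
    have cl': "(\<lambda>C. \<pi> (\<phi> (?t C) s)) \<in> lcosets P \<rightarrow> carrier ?K" if "s \<in> carrier R" for s
      using cl[OF that] by (intro Pi_I \<pi>_closed) (erule funcset_mem)
    have "rel_trace G R \<phi> P (N ?r) \<in> trace_ideal G R \<phi> P"
      using N_inv[OF r] by (simp add: trace_ideal_def)
    then have tr: "rel_trace G R \<phi> P (N ?r) \<in> Q" using sub by blast
    have "(\<Oplus>\<^bsub>?K\<^esub>C\<in>lcosets P. \<pi> (\<phi> (?t C) ?r)) [^]\<^bsub>?K\<^esub> (p ^ k) =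
        (\<Oplus>\<^bsub>?K\<^esub>C\<in>lcosets P. \<pi> (\<phi> (?t C) ?r) [^]\<^bsub>?K\<^esub> (p ^ k))"
      using p K_char cl'[OF r] by (rule K.finsum_prime_power)
    also have "\<dots> = (\<Oplus>\<^bsub>?K\<^esub>C\<in>lcosets P. \<pi> (\<phi> (?t C) (N ?r)))"
      using cl'[OF N_closed[OF r]] N_power[OF tG b] by (intro K.finsum_cong') auto
    also have "\<dots> = \<pi> (rel_trace G R \<phi> P (N ?r))"
      using ring_hom_cring.hom_finsum[OF \<pi>_hom cl[OF N_closed[OF r]]] by (simp add: rel_trace_def comp_def)
    also have "\<dots> = \<zero>\<^bsub>?K\<^esub>"
      using tr by (simp only: \<pi>_zero[OF Q.Icarr[OF tr]])
    finally have "(\<Oplus>\<^bsub>?K\<^esub>C\<in>lcosets P. \<pi> (\<phi> (?t C) ?r)) \<in> {\<zero>\<^bsub>?K\<^esub>}"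
      using primeideal.pow_mem_imp[OF K.zeroprimeideal K.finsum_closed[OF cl'[OF r]]] by blast
    moreover have "(\<Oplus>\<^bsub>?K\<^esub>C\<in>lcosets P. \<pi> (\<phi> (?t C) ?r)) =
        (\<Oplus>\<^bsub>?K\<^esub>C\<in>lcosets P. \<pi> (\<phi> (?t C) a) \<otimes>\<^bsub>?K\<^esub> \<pi> (\<phi> (?t C) b))"
    proof (rule K.finsum_cong'[OF refl])
      show "(\<lambda>C. \<pi> (\<phi> (?t C) a) \<otimes>\<^bsub>?K\<^esub> \<pi> (\<phi> (?t C) b)) \<in> lcosets P \<rightarrow> carrier ?K"
        using cl'[OF a(1)] cl'[OF b] by (intro Pi_I K.m_closed) auto
      show "\<pi> (\<phi> (?t C) ?r) = \<pi> (\<phi> (?t C) a) \<otimes>\<^bsub>?K\<^esub> \<pi> (\<phi> (?t C) b)" if "C \<in> lcosets P" for C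
        using tG[OF that] a(1) b act_closed by (simp add: act_mult \<pi>_mult)
    qed
    ultimately show ?thesis by simp
  qed

  have L: "P \<in> lcosets P"
    using G.lcos_mult_one[OF PG] unfolding LCOSETS_def by blast
  have "?t P \<in> P" by (rule coset_rep_mem(1)[OF P(1) L])
  then have tP: "?t P \<in> inertia_group Q" using P(3) by blast
  let ?E = "{C \<in> lcosets P. ?t C \<in> inertia_group Q}"
  \<comment> \<open>The representative of the coset \<open>P\<close> acts trivially modulo
    \<open>Q\<close>. So the characters equal to its character are those of the representatives in
    the inertia group.\<close>
  have E: "{C \<in> lcosets P. \<forall>b\<in>carrier R. \<pi> (\<phi> (?t C) b) = \<pi> (\<phi> (?t P) b)} = ?E"
    using tP tG inertia inertia_group_iff[OF Q.is_ideal] unfolding \<pi>_def by auto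
  have "(\<Oplus>\<^bsub>?K\<^esub>C\<in>{C \<in> lcosets P. \<forall>b\<in>carrier R. \<pi> (\<phi> (?t C) b) = \<pi> (\<phi> (?t P) b)}. \<pi> (\<phi> (?t C) a)) = \<zero>\<^bsub>?K\<^esub>"
  proof (rule K.weighted_independence_of_characters[OF finL R.monoid_axioms L _ _ _ sum_zero])
    show "(\<lambda>b. \<pi> (\<phi> (?t C) b)) \<in> hom R ?K" if "C \<in> lcosets P" for C
      using tG[OF that] act_closed \<pi>_closed by (auto simp: hom_def act_mult \<pi>_mult)
    show "\<pi> (\<phi> (?t C) \<one>\<^bsub>R\<^esub>) = \<one>\<^bsub>?K\<^esub>" if "C \<in> lcosets P" for C
      using tG[OF that] ring_hom_one[OF \<pi>_ring_hom] by (simp add: act_ring_one)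
    show "(\<lambda>C. \<pi> (\<phi> (?t C) a)) \<in> lcosets P \<rightarrow> carrier ?K"
      using tG a(1) by (intro Pi_I \<pi>_closed act_closed)
  qed
  then have "(\<Oplus>\<^bsub>?K\<^esub>C\<in>?E. \<pi> (\<phi> (?t C) a)) = \<zero>\<^bsub>?K\<^esub>" unfolding E .
  moreover have "(\<Oplus>\<^bsub>?K\<^esub>C\<in>?E. \<pi> (\<phi> (?t C) a)) = (\<Oplus>\<^bsub>?K\<^esub>C\<in>?E. \<pi> a)"
    using a(1) \<pi>_closed by (intro K.finsum_cong') (auto simp: inertia)
  moreover have "(\<Oplus>\<^bsub>?K\<^esub>C\<in>?E. \<pi> a) = [card ?E] \<cdot>\<^bsub>?K\<^esub> \<pi> a"
    using \<pi>_closed[OF a(1)] by (rule K.add.finprod_const)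
  moreover have "card ?E = m"
  proof -
    have "card ?E * p ^ k = m * p ^ k"
      using card_lcosets_meeting_subgroup[OF fin T P(1,3)] P(2) m(1) by (simp add: mult.commute)
    then show ?thesis using prime_gt_0_nat[OF p] by simp
  qed
  ultimately have ma: "[m] \<cdot>\<^bsub>?K\<^esub> \<pi> a = \<zero>\<^bsub>?K\<^esub>" by simp
  have "coprime m p" using p m(2) prime_imp_coprime_nat coprime_commute by blast
  moreover have "m \<noteq> 0" using m(2) by (metis dvd_0_right)
  \<comment> \<open>As \<open>m\<close> is prime to \<open>p\<close>, some multiple of it is 1
    modulo \<open>p\<close>; hence \<open>m\<close> times the class of \<open>a\<close> vanishes
    only if that class does.\<close>
  ultimately obtain u v where uv: "m * u = p * v + 1"
    using bezout_nat[of m p] by (auto simp: coprime_iff_gcd_eq_1)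
  have "[(m * u)] \<cdot>\<^bsub>?K\<^esub> \<pi> a = \<zero>\<^bsub>?K\<^esub>"
    using ma \<pi>_closed[OF a(1)] K.add.nat_pow_pow[of "\<pi> a" u m] by simp
  moreover have "[(p * v + 1)] \<cdot>\<^bsub>?K\<^esub> \<pi> a = \<pi> a"
    using K.add_pow_eq_zero[OF K_char _ \<pi>_closed[OF a(1)], of "p * v"] \<pi>_closed[OF a(1)]
      K.add.nat_pow_mult[of "\<pi> a" "p * v" 1]
    by simp
  ultimately have "\<pi> a = \<zero>\<^bsub>?K\<^esub>" using uv by simp
  then show False using \<pi>_zero[OF a(1)] a(2) by blast
qed

section \<open>Sums of trace ideals and the height formula\<close>

lemma trace_ideal_subset_carrier:
  "subgroup H G \<Longrightarrow> trace_ideal G R \<phi> H \<subseteq> carrier (invariant_ring R \<phi> (carrier G))"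
  using rel_trace_invariant by (auto simp: trace_ideal_def)

lemma zero_in_trace_ideal:
  assumes "subgroup H G"
  shows "\<zero>\<^bsub>R\<^esub> \<in> trace_ideal G R \<phi> H"
proof -
  have "rel_trace G R \<phi> H \<zero>\<^bsub>R\<^esub> = \<zero>\<^bsub>R\<^esub>"
    unfolding rel_trace_def
    using coset_rep_mem(2)[OF assms] by (intro R.add.finprod_one_eqI) (simp add: act_zero)
  moreover have "\<zero>\<^bsub>R\<^esub> \<in> carrier (invariant_ring R \<phi> H)"
    using subgroup.subset[OF assms] by (auto simp: mem_invariant_ring act_zero)
  ultimately show ?thesis unfolding trace_ideal_def by (metis imageI)
qed

text \<open>The set \<open>A\<close> is a general additively closed one, in order to cover both a
  prime ideal of \<open>R\<close> and the ring of invariants.\<close>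

lemma trace_ideal_sum_subset_iff:
  assumes fin: "finite (carrier G)" and F: "\<And>H. H \<in> \<F> \<Longrightarrow> subgroup H G"
    and A: "\<zero>\<^bsub>R\<^esub> \<in> A" "A \<subseteq> carrier R" "\<And>x y. x \<in> A \<Longrightarrow> y \<in> A \<Longrightarrow> x \<oplus>\<^bsub>R\<^esub> y \<in> A"
  shows "trace_ideal_sum G R \<phi> \<F> \<subseteq> A \<longleftrightarrow> (\<forall>H\<in>\<F>. trace_ideal G R \<phi> H \<subseteq> A)"
proof -
  have finF: "finite \<F>"
    using F fin subgroup.subset by (intro finite_subset[of \<F> "Pow (carrier G)"]) auto
  have tR: "trace_ideal G R \<phi> H \<subseteq> carrier R" if "H \<in> \<F>" for H
    using trace_ideal_subset_carrier[OF F[OF that]] by (auto simp: mem_invariant_ring)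
  show ?thesis
  proof (intro iffI ballI subsetI)
    fix H x assume sub: "trace_ideal_sum G R \<phi> \<F> \<subseteq> A" and H: "H \<in> \<F>" and x: "x \<in> trace_ideal G R \<phi> H"
    \<comment> \<open>The family concentrated at \<open>H\<close> exhibits \<open>x\<close> as an
      element of the sum.\<close>
    let ?a = "\<lambda>H'. if H = H' then x else \<zero>\<^bsub>R\<^esub>"
    have "(\<Oplus>\<^bsub>R\<^esub>H'\<in>\<F>. ?a H') = x"
      using R.finsum_singleton[OF H finF, of "\<lambda>_. x"] x tR[OF H] by auto
    moreover have "?a \<in> (\<Pi> H \<in> \<F>. trace_ideal G R \<phi> H)"
      using x zero_in_trace_ideal F by auto
    ultimately have "x \<in> trace_ideal_sum G R \<phi> \<F>"
      unfolding trace_ideal_sum_def by (intro CollectI exI[of _ ?a]) simp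
    then show "x \<in> A" using sub by blast
  next
    fix x assume all: "\<forall>H\<in>\<F>. trace_ideal G R \<phi> H \<subseteq> A" and "x \<in> trace_ideal_sum G R \<phi> \<F>"
    then obtain a where x: "x = (\<Oplus>\<^bsub>R\<^esub>H\<in>\<F>. a H)" and "a \<in> (\<Pi> H \<in> \<F>. trace_ideal G R \<phi> H)"
      by (auto simp: trace_ideal_sum_def)
    then have "a \<in> \<F> \<rightarrow> A" using all by blast
    with finF have "(\<Oplus>\<^bsub>R\<^esub>H\<in>\<F>. a H) \<in> A"
    proof (induction \<F> rule: finite_induct)
      case (insert H \<F>)
      then have "a H \<in> carrier R" "a \<in> \<F> \<rightarrow> carrier R" using A(2) by auto
      then show ?case using insert A(3) by simp
    qed (use A(1) in simp)
    then show "x \<in> A" using x by simp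
  qed
qed

lemma trace_ideal_sum_subset_primeideal_iff:
  assumes fin: "finite (carrier G)" and Q: "primeideal Q R"
    and p: "Factorial_Ring.prime (p::nat)" and char: "[p] \<cdot>\<^bsub>R\<^esub> \<one>\<^bsub>R\<^esub> = \<zero>\<^bsub>R\<^esub>"
    and F: "\<And>H. H \<in> \<F> \<Longrightarrow> subgroup H G"
    and conj: "\<And>H g. H \<in> \<F> \<Longrightarrow> g \<in> carrier G \<Longrightarrow> g <# H #> inv g \<in> \<F>"
    and down: "\<And>H K. H \<in> \<F> \<Longrightarrow> subgroup K G \<Longrightarrow> K \<subseteq> H \<Longrightarrow> K \<in> \<F>"
  shows "trace_ideal_sum G R \<phi> \<F> \<subseteq> Q \<longleftrightarrow>
    (\<exists>P. subgroup P G \<and> (\<exists>k. card P = p ^ k) \<and> P \<notin> \<F> \<and> augmentation_ideal R \<phi> P \<subseteq> Q)"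
proof -
  interpret Q: primeideal Q R by fact
  have sum_iff: "trace_ideal_sum G R \<phi> \<F> \<subseteq> Q \<longleftrightarrow> (\<forall>H\<in>\<F>. trace_ideal G R \<phi> H \<subseteq> Q)"
    using Q.a_subset by (intro trace_ideal_sum_subset_iff[OF fin F]) auto
  show ?thesis
  proof
    assume sub: "trace_ideal_sum G R \<phi> \<F> \<subseteq> Q"
    let ?T = "inertia_group Q"
    have T: "subgroup ?T G" using Q.is_ideal by (rule subgroup_inertia_group)
    have finT: "finite ?T" using finite_subset[OF subgroup.subset[OF T] fin] .
    interpret T: group "G\<lparr>carrier := ?T\<rparr>"
      using T by (rule subgroup.subgroup_is_group) (rule G.group_axioms)
    have "card ?T \<noteq> 0" using finT subgroup.one_closed[OF T] by auto
    \<comment> \<open>With the full multiplicity of \<open>p\<close> as exponent, \<open>P\<close>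
      below is a Sylow subgroup of the inertia group. Its trace ideal is not inside
      \<open>Q\<close>, so it cannot belong to \<open>\<F>\<close>.\<close>
    then obtain m where m: "card ?T = p ^ multiplicity p (card ?T) * m" "\<not> p dvd m"
      using multiplicity_decompose'[of "card ?T" p] p by (metis not_prime_unit)
    define k where "k = multiplicity p (card ?T)"
    obtain P where P: "subgroup P (G\<lparr>carrier := ?T\<rparr>)" "card P = p ^ k"
      using sylow_thm[OF p T.group_axioms, of k m] m(1) finT by (auto simp: order_def k_def)
    have PT: "P \<subseteq> ?T" using subgroup.subset[OF P(1)] by simp
    have PG: "subgroup P G" using T P(1) by (rule G.incl_subgroup)
    have "\<not> trace_ideal G R \<phi> P \<subseteq> Q"
      using trace_ideal_not_subset[OF fin Q p char PG P(2) PT] m unfolding k_def by blast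
    then have "P \<notin> \<F>" using sub sum_iff by blast
    moreover have "augmentation_ideal R \<phi> P \<subseteq> Q"
      using augmentation_ideal_subset_iff[OF Q.is_ideal subgroup.subset[OF PG]] PT by blast
    ultimately show "\<exists>P. subgroup P G \<and> (\<exists>k. card P = p ^ k) \<and> P \<notin> \<F> \<and> augmentation_ideal R \<phi> P \<subseteq> Q"
      using PG P(2) by blast
  next
    assume "\<exists>P. subgroup P G \<and> (\<exists>k. card P = p ^ k) \<and> P \<notin> \<F> \<and> augmentation_ideal R \<phi> P \<subseteq> Q"
    then obtain P k where P: "subgroup P G" "card P = p ^ k" "P \<notin> \<F>" "augmentation_ideal R \<phi> P \<subseteq> Q"
      by blast
    have PT: "P \<subseteq> inertia_group Q"
      using augmentation_ideal_subset_iff[OF Q.is_ideal subgroup.subset[OF P(1)]] P(4) by blast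
    have "trace_ideal G R \<phi> H \<subseteq> Q" if H: "H \<in> \<F>" for H
    proof (rule trace_ideal_subset[OF fin Q p char P(1,2) PT F[OF H]])
      \<comment> \<open>Inside a conjugate of \<open>H\<close>, the group \<open>P\<close> would
        belong to \<open>\<F>\<close> by the two closure properties.\<close>
      show "\<not> P \<subseteq> a <# H #> inv a" if "a \<in> carrier G" for a
        using down[OF conj[OF H that] P(1)] P(3) by blast
    qed
    then show "trace_ideal_sum G R \<phi> \<F> \<subseteq> Q" using sum_iff by blast
  qed
qed

text \<open>By \<open>lying_over\<close>, the primes of the invariant ring above \<open>I\<close>
  are the contractions of the primes of \<open>R\<close> above \<open>I\<close>, and heights agree.
  Several primes of \<open>R\<close> may share a contraction, which does not affect the
  infimum.\<close>

lemma height_invariant_ring: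
  assumes fin: "finite (carrier G)" and I: "I \<subseteq> carrier (invariant_ring R \<phi> (carrier G))"
  shows "height (invariant_ring R \<phi> (carrier G)) I = (INF Q \<in> {Q. primeideal Q R \<and> I \<subseteq> Q}. prime_height R Q)"
proof -
  let ?S = "invariant_ring R \<phi> (carrier G)"
  have "{q. primeideal q ?S \<and> I \<subseteq> q} = (\<lambda>Q. Q \<inter> carrier ?S) ` {Q. primeideal Q R \<and> I \<subseteq> Q}"
  proof (intro subset_antisym subsetI)
    fix q assume "q \<in> {q. primeideal q ?S \<and> I \<subseteq> q}"
    then obtain Q where "primeideal Q R" "Q \<inter> carrier ?S = q" "I \<subseteq> q"
      using lying_over[OF fin, of q] by blast
    then show "q \<in> (\<lambda>Q. Q \<inter> carrier ?S) ` {Q. primeideal Q R \<and> I \<subseteq> Q}" by blast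
  next
    fix q assume "q \<in> (\<lambda>Q. Q \<inter> carrier ?S) ` {Q. primeideal Q R \<and> I \<subseteq> Q}"
    then show "q \<in> {q. primeideal q ?S \<and> I \<subseteq> q}"
      using I primeideal_contraction[OF _ subset_refl] by blast
  qed
  then show ?thesis
    unfolding height_def by (simp only: image_image) (intro INF_cong refl, simp add: prime_height_contraction[OF fin])
qed

end

lemma INF_UN:
  fixes f :: "'a \<Rightarrow> 'b::complete_lattice"
  shows "(INF x \<in> (\<Union>y\<in>A. B y). f x) = (INF y \<in> A. INF x \<in> B y. f x)"
proof (rule order.antisym)
  show "(INF x \<in> (\<Union>y\<in>A. B y). f x) \<le> (INF y \<in> A. INF x \<in> B y. f x)"
    by (intro INF_greatest INF_lower) blast
  show "(INF y \<in> A. INF x \<in> B y. f x) \<le> (INF x \<in> (\<Union>y\<in>A. B y). f x)"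
    by (auto intro!: INF_greatest intro: INF_lower2 INF_lower)
qed

theorem lemma1p2:
  fixes G :: "('g, 'm) monoid_scheme" and R :: "('r, 'n) ring_scheme"
    and \<phi> :: "'g \<Rightarrow> 'r \<Rightarrow> 'r" and p :: nat and \<F> :: "'g set set"
  assumes "finite (carrier G)"
    and "ring_action G R \<phi>"
    and "Factorial_Ring.prime p"
    and "\<exists>f \<in> ring_hom (ZFact (int p)) R. inj_on f (carrier (ZFact (int p)))"
    and "\<And>H. H \<in> \<F> \<Longrightarrow> subgroup H G"
    and "\<And>H g. H \<in> \<F> \<Longrightarrow> g \<in> carrier G \<Longrightarrow> g <#\<^bsub>G\<^esub> H #>\<^bsub>G\<^esub> inv\<^bsub>G\<^esub> g \<in> \<F>"
    and "\<And>H K. H \<in> \<F> \<Longrightarrow> subgroup K G \<Longrightarrow> K \<subseteq> H \<Longrightarrow> K \<in> \<F>"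
  shows "height (invariant_ring R \<phi> (carrier G)) (trace_ideal_sum G R \<phi> \<F>) =
    (INF P \<in> {P. subgroup P G \<and> (\<exists>k. card P = p ^ k) \<and> P \<notin> \<F>}.
       height R (augmentation_ideal R \<phi> P))"
proof -
  interpret ring_action G R \<phi> by fact
  let ?S = "invariant_ring R \<phi> (carrier G)"
  let ?P = "{P. subgroup P G \<and> (\<exists>k. card P = p ^ k) \<and> P \<notin> \<F>}"
  have char: "[p] \<cdot>\<^bsub>R\<^esub> \<one>\<^bsub>R\<^esub> = \<zero>\<^bsub>R\<^esub>"
    using assms(4) char_of_ZFact_hom[OF R.ring_axioms] by blast
  interpret S: cring ?S by (rule cring_invariant_ring) simp
  have "trace_ideal_sum G R \<phi> \<F> \<subseteq> carrier ?S"
    using S.zero_closed S.a_closed trace_ideal_subset_carrier[OF assms(5)]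
    by (subst trace_ideal_sum_subset_iff[OF assms(1,5)]) (auto simp: mem_invariant_ring)
  then have "height ?S (trace_ideal_sum G R \<phi> \<F>) =
      (INF Q \<in> {Q. primeideal Q R \<and> trace_ideal_sum G R \<phi> \<F> \<subseteq> Q}. prime_height R Q)"
    by (rule height_invariant_ring[OF assms(1)])
  \<comment> \<open>With this description, the infimum over the primes splits into an infimum of
    heights of augmentation ideals. If \<open>?P\<close> is empty, both infima are
    \<infinity>.\<close>
  moreover have "{Q. primeideal Q R \<and> trace_ideal_sum G R \<phi> \<F> \<subseteq> Q} =
      (\<Union>P\<in>?P. {Q. primeideal Q R \<and> augmentation_ideal R \<phi> P \<subseteq> Q})"
  proof (intro Set.set_eqI)
    fix Q
    have "trace_ideal_sum G R \<phi> \<F> \<subseteq> Q \<longleftrightarrow>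
        (\<exists>P. subgroup P G \<and> (\<exists>k. card P = p ^ k) \<and> P \<notin> \<F> \<and> augmentation_ideal R \<phi> P \<subseteq> Q)"
      if "primeideal Q R"
      by (rule trace_ideal_sum_subset_primeideal_iff[OF assms(1) that assms(3) char]) (fact assms)+
    then show "Q \<in> {Q. primeideal Q R \<and> trace_ideal_sum G R \<phi> \<F> \<subseteq> Q} \<longleftrightarrow>
        Q \<in> (\<Union>P\<in>?P. {Q. primeideal Q R \<and> augmentation_ideal R \<phi> P \<subseteq> Q})"
      by blast
  qed
  ultimately show ?thesis
    unfolding height_def by (simp only: INF_UN)
qed

end
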